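(* Let $q$ satisfy condition $\mathbf{A}$ for $x\ge x_0$, and suppose $\rho(x)\to+\infty$ as $x\to+\infty$. Then for every $\lambda\notin\sigma(L_U)$ the resolvent $R_\lambda=(L_U-\lambda)^{-1}$ is a compact (completely continuous) operator on $L_2(\mathbb{R}_+)$.
   Context: $\mathbb{R}_+=[0,+\infty)$. Let $q\in L_{1,loc}(\mathbb{R}_+)$ be complex-valued and $l(y)=-y''+q(x)y$. The maximal domain is $D=\{y\in L_2(\mathbb{R}_+): y,y'\in AC_{loc}(\mathbb{R}_+),\ l(y)\in L_2(\mathbb{R}_+)\}$. For $\alpha_0,\alpha_1\in\mathbb{C}$ with $|\alpha_0|+|\alpha_1|\ne0$ put $U(y)=\alpha_0y(0)+\alpha_1y'(0)$, $D_U=\{y\in D: U(y)=0\}$, and $L_Uy=l(y)$ for $y\in D_U$. For $\kappa\ge 0$ let $\Pi_\kappa=\{z\in\mathbb{C}: z\neq 0,\ \arg z\in(-\pi+\kappa,\pi-\kappa)\}$. $q$ satisfies condition $\mathbf{A}$ for $x\ge x_0$ if: (i) $q\in L_{1,loc}(\mathbb{R}_+)$ and $q$ is locally absolutely continuous on $[x_0,+\infty)$; (ii) $q([x_0,+\infty))\subset\Pi_\kappa$ for some $\kappa\ge0$; (iii) there is $C>0$ with $\operatorname{Re}p(x)\ge C+\frac12|p'(x)/p(x)|$ for a.e. $x\ge x_0$, where $p=\sqrt{q}$ with $\operatorname{Re}p>0$ on $[x_0,\infty)$. For $x\ge x_0$ set $\rho(x)=\operatorname{Re}p(x)-\frac12\bigl|p'(x)/p(x)\bigr|$.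 *)

theory Defs
  imports "HOL-Analysis.Analysis"
begin

definition AC_on :: "real \<Rightarrow> real \<Rightarrow> (real \<Rightarrow> complex) \<Rightarrow> bool" where
  "AC_on a b f \<longleftrightarrow>
     (\<forall>\<epsilon>>0. \<exists>\<delta>>0. \<forall>(n::nat) (u::nat \<Rightarrow> real) (v::nat \<Rightarrow> real).
        (\<forall>i<n. a \<le> u i \<and> u i \<le> v i \<and> v i \<le> b) \<and>
        (\<forall>i<n. \<forall>j<n. i \<noteq> j \<longrightarrow> v i \<le> u j \<or> v j \<le> u i) \<and>
        (\<Sum>i<n. v i - u i) < \<delta>
        \<longrightarrow> (\<Sum>i<n. cmod (f (v i) - f (u i))) < \<epsilon>)"

definition AC_loc_from :: "real \<Rightarrow> (real \<Rightarrow> complex) \<Rightarrow> bool" where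
  "AC_loc_from a f \<longleftrightarrow> (\<forall>b\<ge>a. AC_on a b f)"

definition L1_loc :: "(real \<Rightarrow> complex) \<Rightarrow> bool" where
  "L1_loc q \<longleftrightarrow> (\<forall>b\<ge>0. q absolutely_integrable_on {0..b})"

definition dR :: "real \<Rightarrow> (real \<Rightarrow> complex) \<Rightarrow> real \<Rightarrow> complex" where
  "dR a f x = vector_derivative f (at x within {a..})"

definition L2 :: "(real \<Rightarrow> complex) set" where
  "L2 = {f. f \<in> borel_measurable (lebesgue_on {0..}) \<and>
            integrable (lebesgue_on {0..}) (\<lambda>x. (cmod (f x))\<^sup>2)}"

definition L2norm :: "(real \<Rightarrow> complex) \<Rightarrow> real" where
  "L2norm f = sqrt (integral\<^sup>L (lebesgue_on {0..}) (\<lambda>x. (cmod (f x))\<^sup>2))"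

definition ae_eq :: "(real \<Rightarrow> complex) \<Rightarrow> (real \<Rightarrow> complex) \<Rightarrow> bool" where
  "ae_eq f g \<longleftrightarrow> (AE x in lebesgue_on {0..}. f x = g x)"

definition lexpr :: "(real \<Rightarrow> complex) \<Rightarrow> (real \<Rightarrow> complex) \<Rightarrow> real \<Rightarrow> complex" where
  "lexpr q y x = - dR 0 (dR 0 y) x + q x * y x"

definition Dmax :: "(real \<Rightarrow> complex) \<Rightarrow> (real \<Rightarrow> complex) set" where
  "Dmax q = {y. y \<in> L2 \<and> AC_loc_from 0 y \<and> AC_loc_from 0 (dR 0 y) \<and> lexpr q y \<in> L2}"

definition DU :: "(real \<Rightarrow> complex) \<Rightarrow> complex \<Rightarrow> complex \<Rightarrow> (real \<Rightarrow> complex) set" where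
  "DU q \<alpha>0 \<alpha>1 = {y \<in> Dmax q. \<alpha>0 * y 0 + \<alpha>1 * dR 0 y 0 = 0}"

definition resolvent_set_LU :: "(real \<Rightarrow> complex) \<Rightarrow> complex \<Rightarrow> complex \<Rightarrow> complex set" where
  "resolvent_set_LU q \<alpha>0 \<alpha>1 = {lam.
     (\<forall>y\<in>DU q \<alpha>0 \<alpha>1. ae_eq (\<lambda>x. lexpr q y x - lam * y x) (\<lambda>x. 0) \<longrightarrow> ae_eq y (\<lambda>x. 0)) \<and>
     (\<forall>f\<in>L2. \<exists>y\<in>DU q \<alpha>0 \<alpha>1. ae_eq (\<lambda>x. lexpr q y x - lam * y x) f) \<and>
     (\<exists>K. \<forall>y\<in>DU q \<alpha>0 \<alpha>1. L2norm y \<le> K * L2norm (\<lambda>x. lexpr q y x - lam * y x))}"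

definition spectrum_LU :: "(real \<Rightarrow> complex) \<Rightarrow> complex \<Rightarrow> complex \<Rightarrow> complex set" where
  "spectrum_LU q \<alpha>0 \<alpha>1 = - resolvent_set_LU q \<alpha>0 \<alpha>1"

definition is_resolvent_LU ::
  "(real \<Rightarrow> complex) \<Rightarrow> complex \<Rightarrow> complex \<Rightarrow> complex \<Rightarrow>
   ((real \<Rightarrow> complex) \<Rightarrow> (real \<Rightarrow> complex)) \<Rightarrow> bool" where
  "is_resolvent_LU q \<alpha>0 \<alpha>1 lam R \<longleftrightarrow>
     (\<forall>f\<in>L2. R f \<in> DU q \<alpha>0 \<alpha>1 \<and> ae_eq (\<lambda>x. lexpr q (R f) x - lam * R f x) f)"

definition compact_op_L2 :: "((real \<Rightarrow> complex) \<Rightarrow> (real \<Rightarrow> complex)) \<Rightarrow> bool" where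
  "compact_op_L2 R \<longleftrightarrow>
     (\<forall>f::nat \<Rightarrow> real \<Rightarrow> complex. (\<forall>n. f n \<in> L2) \<and> (\<exists>B. \<forall>n. L2norm (f n) \<le> B) \<longrightarrow>
        (\<exists>r g. strict_mono r \<and> g \<in> L2 \<and>
               (\<lambda>n. L2norm (\<lambda>x. R (f (r n)) x - g x)) \<longlonglongrightarrow> 0))"

definition Pi_sector :: "real \<Rightarrow> complex set" where
  "Pi_sector \<kappa> = {z. z \<noteq> 0 \<and> - pi + \<kappa> < Arg z \<and> Arg z < pi - \<kappa>}"

text \<open>p = sqrt q (principal branch, Re p > 0 on the sector).\<close>
definition pfun :: "(real \<Rightarrow> complex) \<Rightarrow> real \<Rightarrow> complex" where
  "pfun q x = csqrt (q x)"

definition rho :: "(real \<Rightarrow> complex) \<Rightarrow> real \<Rightarrow> real \<Rightarrow> real" where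
  "rho q x0 x = Re (pfun q x) - cmod (dR x0 (pfun q) x / pfun q x) / 2"

definition condA :: "(real \<Rightarrow> complex) \<Rightarrow> real \<Rightarrow> bool" where
  "condA q x0 \<longleftrightarrow>
     L1_loc q \<and> AC_loc_from x0 q \<and>
     (\<exists>\<kappa>\<ge>0. \<forall>x\<ge>x0. q x \<in> Pi_sector \<kappa>) \<and>
     (\<forall>x\<ge>x0. Re (pfun q x) > 0) \<and>
     (\<exists>C>0. AE x in lebesgue_on {x0..}.
        Re (pfun q x) \<ge> C + cmod (dR x0 (pfun q) x / pfun q x) / 2)"

end

theory Submission
  imports Defs "HOL-Complex_Analysis.Great_Picard"
begin

text \<open>Let \<open>y \<in> D\<close> with \<open>y\<close> and \<open>g = l(y)\<close> bounded in \<open>L\<^sub>2\<close>, and put \<open>W = Re (cnj y * y' / p)\<close>.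
  The equation \<open>y'' = p\<^sup>2 y - g\<close> gives
  \<open>W' \<ge> \<rho> (|y|\<^sup>2 + |y'/p|\<^sup>2) - h\<close> with \<open>h = (|y|\<^sup>2 + |g|\<^sup>2) / (2 C)\<close>.
  Since \<open>y \<in> L\<^sub>2\<close>, this forces \<open>W\<close> to stay below the integral \<open>S\<close> of \<open>h\<close>; integrating the
  inequality over \<open>[X, \<infinity>)\<close>, where \<open>\<rho> \<ge> m\<close>, yields
  \<open>m \<integral>|y|\<^sup>2 \<le> 3 S - W(x\<^sub>0)\<close>, so the \<open>L\<^sub>2\<close> tails are uniformly small. On compact intervals \<open>y\<close> and
  \<open>y'\<close> are uniformly bounded, whence a pointwise convergent subsequence exists, and it
  converges in \<open>L\<^sub>2\<close>. The resolvent enters only through its boundedness.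

  The almost everywhere differentiability of absolutely continuous functions is obtained from
  Radon-Nikodym: \<open>f\<close> is a difference of its variation and another monotone function, and the
  Stieltjes measures of both are absolutely continuous.\<close>

section \<open>Absolutely continuous functions\<close>

text \<open>Dividing \<open>y'\<close> by \<open>p\<close> is what makes condition A fit. With
  \<open>s = y'/p\<close>, differentiating \<open>W * p = cnj y * y'\<close> (before real parts are
  taken) gives \<open>W' = p |y|^2 + cnj p |s|^2 - cnj y * g / p - cnj y * s * p'/p\<close>. Since
  \<open>p\<close> and \<open>cnj p\<close> have the same real part, both squares carry the weight
  \<open>Re p\<close>; the last term costs at most half of \<open>|p'/p|\<close> times
  \<open>|y|^2 + |s|^2\<close>, and the difference of the two weights is \<open>rho\<close>. At
  infinity nothing is known about the decay of \<open>y'\<close>, so the boundary term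
  \<open>W(b)\<close> cannot simply be sent to 0. An upper bound suffices, and a Riccati-type
  argument for \<open>-1/W\<close> supplies it. A second obstacle is that \<open>dR\<close> is a
  \<open>vector_derivative\<close>, whose value says nothing where no derivative exists. Pointwise
  hypotheses are therefore phrased for every \<open>D\<close> that really is a derivative, and
  integrating them needs such derivatives almost everywhere. This is why the fundamental theorem for
  absolutely continuous functions is developed at length.\<close>

definition nonoverlap :: "'i set \<Rightarrow> ('i \<Rightarrow> real) \<Rightarrow> ('i \<Rightarrow> real) \<Rightarrow> real \<Rightarrow> real \<Rightarrow> bool" where
  "nonoverlap I u v a b \<longleftrightarrow> finite I \<and> (\<forall>i\<in>I. a \<le> u i \<and> u i \<le> v i \<and> v i \<le> b) \<and>
     (\<forall>i\<in>I. \<forall>j\<in>I. i \<noteq> j \<longrightarrow> v i \<le> u j \<or> v j \<le> u i)"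

lemma nonoverlap_reindex:
  assumes "nonoverlap I u v a b" "bij_betw h J I"
  shows "nonoverlap J (u \<circ> h) (v \<circ> h) a b"
proof -
  have fin: "finite J" using assms bij_betw_finite unfolding nonoverlap_def by blast
  have mem: "h j \<in> I" if "j \<in> J" for j using assms(2) that by (auto simp: bij_betw_def)
  have ne: "h i \<noteq> h j" if "i \<in> J" "j \<in> J" "i \<noteq> j" for i j
    using assms(2) that by (auto simp: bij_betw_def inj_on_def)
  show ?thesis using assms(1) fin mem ne unfolding nonoverlap_def o_def by simp
qed

lemma nonoverlap_enum:
  assumes "nonoverlap I u v a b"
  obtains h :: "nat \<Rightarrow> 'i" where "bij_betw h {..<card I} I" "nonoverlap {..<card I} (u \<circ> h) (v \<circ> h) a b"
proof -
  have "finite I" using assms by (simp add: nonoverlap_def)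
  then obtain h where "bij_betw h {..<card I} I"
    using ex_bij_betw_nat_finite[of I] by (auto simp: atLeast0LessThan)
  with nonoverlap_reindex[OF assms this] that show ?thesis by blast
qed

text \<open>\<open>AC_on\<close> enumerates its intervals by initial segments of the naturals.
  Freeing the index type allows families refined over pairs in \<open>AC_on_variation\<close> and
  families indexed by the intervals themselves in \<open>interval_measure_AC_null\<close>.\<close>

lemma AC_on_family:
  assumes "AC_on a b f" "\<epsilon> > 0"
  obtains \<delta> where "\<delta> > 0"
    "\<And>(I :: 'i set) u v. nonoverlap I u v a b \<Longrightarrow> (\<Sum>i\<in>I. v i - u i) < \<delta> \<Longrightarrow>
        (\<Sum>i\<in>I. cmod (f (v i) - f (u i))) < \<epsilon>"
proof -
  obtain \<delta> where "\<delta> > 0" and d: "\<forall>(n::nat) u v.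
      (\<forall>i<n. a \<le> u i \<and> u i \<le> v i \<and> v i \<le> b) \<and>
      (\<forall>i<n. \<forall>j<n. i \<noteq> j \<longrightarrow> v i \<le> u j \<or> v j \<le> u i) \<and>
      (\<Sum>i<n. v i - u i) < \<delta> \<longrightarrow> (\<Sum>i<n. cmod (f (v i) - f (u i))) < \<epsilon>"
    using assms(1)[unfolded AC_on_def, THEN spec, THEN mp, OF assms(2)] by (elim exE conjE)
  show ?thesis
  proof (rule that[OF \<open>\<delta> > 0\<close>])
    fix I :: "'i set" and u v
    assume no: "nonoverlap I u v a b" and s: "(\<Sum>i\<in>I. v i - u i) < \<delta>"
    obtain h where h: "bij_betw h {..<card I} I" "nonoverlap {..<card I} (u \<circ> h) (v \<circ> h) a b"
      using nonoverlap_enum[OF no] .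
    have "(\<Sum>i<card I. (v \<circ> h) i - (u \<circ> h) i) = (\<Sum>i\<in>I. v i - u i)"
      using sum.reindex_bij_betw[OF h(1), of "\<lambda>i. v i - u i"] by simp
    moreover have "(\<Sum>i<card I. cmod (f ((v \<circ> h) i) - f ((u \<circ> h) i))) = (\<Sum>i\<in>I. cmod (f (v i) - f (u i)))"
      using sum.reindex_bij_betw[OF h(1), of "\<lambda>i. cmod (f (v i) - f (u i))"] by simp
    ultimately show "(\<Sum>i\<in>I. cmod (f (v i) - f (u i))) < \<epsilon>"
      using d[rule_format, of "card I" "u \<circ> h" "v \<circ> h"] h(2) s
      by (auto simp: nonoverlap_def)
  qed
qed

lemma AC_onI:
  assumes "\<And>\<epsilon>. \<epsilon> > 0 \<Longrightarrow> \<exists>\<delta>>0. \<forall>(I :: nat set) u v. nonoverlap I u v a b \<longrightarrow>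
      (\<Sum>i\<in>I. v i - u i) < \<delta> \<longrightarrow> (\<Sum>i\<in>I. cmod (f (v i) - f (u i))) < \<epsilon>"
  shows "AC_on a b f"
  unfolding AC_on_def
proof (intro allI impI)
  fix \<epsilon> :: real assume "\<epsilon> > 0"
  then obtain \<delta> where "\<delta> > 0" and d: "\<And>(I :: nat set) u v. nonoverlap I u v a b \<Longrightarrow>
      (\<Sum>i\<in>I. v i - u i) < \<delta> \<Longrightarrow> (\<Sum>i\<in>I. cmod (f (v i) - f (u i))) < \<epsilon>"
    using assms[OF \<open>\<epsilon> > 0\<close>] by (elim exE conjE) blast
  show "\<exists>\<delta>>0. \<forall>(n::nat) u v. (\<forall>i<n. a \<le> u i \<and> u i \<le> v i \<and> v i \<le> b) \<and>
      (\<forall>i<n. \<forall>j<n. i \<noteq> j \<longrightarrow> v i \<le> u j \<or> v j \<le> u i) \<and>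
      (\<Sum>i<n. v i - u i) < \<delta> \<longrightarrow> (\<Sum>i<n. cmod (f (v i) - f (u i))) < \<epsilon>"
  proof (intro exI[of _ \<delta>] conjI allI impI \<open>\<delta> > 0\<close>)
    fix n :: nat and u v
    assume "(\<forall>i<n. a \<le> u i \<and> u i \<le> v i \<and> v i \<le> b) \<and>
      (\<forall>i<n. \<forall>j<n. i \<noteq> j \<longrightarrow> v i \<le> u j \<or> v j \<le> u i) \<and> (\<Sum>i<n. v i - u i) < \<delta>"
    then show "(\<Sum>i<n. cmod (f (v i) - f (u i))) < \<epsilon>"
      by (intro d) (auto simp: nonoverlap_def)
  qed
qed

text \<open>All closure properties below (differences, products, inverses, square roots) reduce to a
  comparison of increments, so that the epsilon-delta argument is made only once.\<close>

lemma AC_on_dominated2: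
  assumes "AC_on a b f" "AC_on a b g" "K \<ge> 0"
    and "\<And>x y. a \<le> x \<Longrightarrow> x \<le> y \<Longrightarrow> y \<le> b \<Longrightarrow>
           cmod (F y - F x) \<le> K * (cmod (f y - f x) + cmod (g y - g x))"
  shows "AC_on a b F"
proof (rule AC_onI)
  fix \<epsilon> :: real assume "\<epsilon> > 0"
  \<comment> \<open>The two families contribute at most \<open>2 * K * e\<close>; writing
    \<open>K + 1\<close> keeps the denominator positive for \<open>K = 0\<close> and makes the final
    inequality strict.\<close>
  define e where "e = \<epsilon> / (2 * (K + 1))"
  have "e > 0" using \<open>\<epsilon> > 0\<close> \<open>K \<ge> 0\<close> by (simp add: e_def)
  obtain d1 where d1: "d1 > 0" "\<And>(I :: nat set) u v. nonoverlap I u v a b \<Longrightarrow>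
      (\<Sum>i\<in>I. v i - u i) < d1 \<Longrightarrow> (\<Sum>i\<in>I. cmod (f (v i) - f (u i))) < e"
    using AC_on_family[OF assms(1) \<open>e > 0\<close>] by metis
  obtain d2 where d2: "d2 > 0" "\<And>(I :: nat set) u v. nonoverlap I u v a b \<Longrightarrow>
      (\<Sum>i\<in>I. v i - u i) < d2 \<Longrightarrow> (\<Sum>i\<in>I. cmod (g (v i) - g (u i))) < e"
    using AC_on_family[OF assms(2) \<open>e > 0\<close>] by metis
  have "(\<Sum>i\<in>I. cmod (F (v i) - F (u i))) < \<epsilon>"
    if no: "nonoverlap I u v a b" and s: "(\<Sum>i\<in>I. v i - u i) < min d1 d2" for I :: "nat set" and u v
  proof -
    have "(\<Sum>i\<in>I. cmod (F (v i) - F (u i))) \<le> (\<Sum>i\<in>I. K * (cmod (f (v i) - f (u i)) + cmod (g (v i) - g (u i))))"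
      using no by (intro sum_mono assms(4)) (auto simp: nonoverlap_def)
    also have "\<dots> = K * ((\<Sum>i\<in>I. cmod (f (v i) - f (u i))) + (\<Sum>i\<in>I. cmod (g (v i) - g (u i))))"
      by (simp add: sum.distrib flip: sum_distrib_left)
    also have "\<dots> \<le> K * (e + e)"
      using d1(2)[OF no] d2(2)[OF no] s \<open>K \<ge> 0\<close> by (intro mult_left_mono add_mono) auto
    also have "\<dots> = 2 * (K + 1) * e - 2 * e" by (simp add: algebra_simps)
    also have "\<dots> < \<epsilon>" using \<open>e > 0\<close> \<open>K \<ge> 0\<close> by (simp add: e_def)
    finally show ?thesis .
  qed
  then show "\<exists>\<delta>>0. \<forall>(I :: nat set) u v. nonoverlap I u v a b \<longrightarrow>
      (\<Sum>i\<in>I. v i - u i) < \<delta> \<longrightarrow> (\<Sum>i\<in>I. cmod (F (v i) - F (u i))) < \<epsilon>"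
    using d1(1) d2(1) by (intro exI[of _ "min d1 d2"]) auto
qed

lemma AC_on_dominated:
  assumes "AC_on a b f" "K \<ge> 0"
    and "\<And>x y. a \<le> x \<Longrightarrow> x \<le> y \<Longrightarrow> y \<le> b \<Longrightarrow> cmod (F y - F x) \<le> K * cmod (f y - f x)"
  shows "AC_on a b F"
proof (rule AC_on_dominated2[OF assms(1) assms(1) assms(2)])
  fix x y assume "a \<le> x" "x \<le> y" "y \<le> b"
  then have "cmod (F y - F x) \<le> K * cmod (f y - f x)" by (rule assms(3))
  also have "\<dots> \<le> K * (cmod (f y - f x) + cmod (f y - f x))"
    using assms(2) by (intro mult_left_mono) auto
  finally show "cmod (F y - F x) \<le> K * (cmod (f y - f x) + cmod (f y - f x))" .
qed

lemma AC_on_subinterval: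
  assumes "AC_on a b f" "a \<le> c" "d \<le> b" shows "AC_on c d f"
proof (rule AC_onI)
  fix \<epsilon> :: real assume "\<epsilon> > 0"
  obtain \<delta> where \<delta>: "\<delta> > 0" "\<And>(I :: nat set) u v. nonoverlap I u v a b \<Longrightarrow>
      (\<Sum>i\<in>I. v i - u i) < \<delta> \<Longrightarrow> (\<Sum>i\<in>I. cmod (f (v i) - f (u i))) < \<epsilon>"
    using AC_on_family[OF assms(1) \<open>\<epsilon> > 0\<close>] by metis
  have "nonoverlap I u v a b" if "nonoverlap I u v c d" for I :: "nat set" and u v
    using that assms(2,3) unfolding nonoverlap_def by fastforce
  then show "\<exists>\<delta>>0. \<forall>(I :: nat set) u v. nonoverlap I u v c d \<longrightarrow>
      (\<Sum>i\<in>I. v i - u i) < \<delta> \<longrightarrow> (\<Sum>i\<in>I. cmod (f (v i) - f (u i))) < \<epsilon>"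
    using \<delta> by blast
qed

lemma AC_on_continuous:
  assumes "AC_on a b f" shows "continuous_on {a..b} f"
  unfolding continuous_on_iff
proof (intro ballI allI impI)
  fix x and e :: real assume x: "x \<in> {a..b}" and "e > 0"
  obtain d where d: "d > 0" "\<And>(I :: nat set) u v. nonoverlap I u v a b \<Longrightarrow>
      (\<Sum>i\<in>I. v i - u i) < d \<Longrightarrow> (\<Sum>i\<in>I. cmod (f (v i) - f (u i))) < e"
    using AC_on_family[OF assms \<open>e > 0\<close>] by metis
  show "\<exists>d>0. \<forall>x'\<in>{a..b}. dist x' x < d \<longrightarrow> dist (f x') (f x) < e"
  proof (intro exI[of _ d] conjI ballI impI d(1))
    fix y assume y: "y \<in> {a..b}" "dist y x < d"
    have "nonoverlap {0::nat} (\<lambda>_. min x y) (\<lambda>_. max x y) a b"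
      using x y by (auto simp: nonoverlap_def)
    from d(2)[OF this] y(2) show "dist (f y) (f x) < e"
      by (cases "x \<le> y") (auto simp: dist_norm norm_minus_commute)
  qed
qed

lemma AC_on_diff:
  assumes "AC_on a b f" "AC_on a b g" shows "AC_on a b (\<lambda>x. f x - g x)"
proof (rule AC_on_dominated2[OF assms, of 1])
  fix x y
  have "f y - g y - (f x - g x) = (f y - f x) - (g y - g x)" by simp
  then show "cmod (f y - g y - (f x - g x)) \<le> 1 * (cmod (f y - f x) + cmod (g y - g x))"
    by (metis norm_triangle_ineq4 mult_1)
qed simp

lemma AC_on_of_real_Re: "AC_on a b f \<Longrightarrow> AC_on a b (\<lambda>x. of_real (Re (f x)))"
  by (rule AC_on_dominated[where K = 1]) (use abs_Re_le_cmod in \<open>auto simp flip: of_real_diff minus_complex.simps(1)\<close>)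

lemma AC_on_of_real_Im: "AC_on a b f \<Longrightarrow> AC_on a b (\<lambda>x. of_real (Im (f x)))"
  by (rule AC_on_dominated[where K = 1]) (use abs_Im_le_cmod in \<open>auto simp flip: of_real_diff minus_complex.simps(2)\<close>)

lemma AC_on_cnj: "AC_on a b f \<Longrightarrow> AC_on a b (\<lambda>x. cnj (f x))"
  by (rule AC_on_dominated[where K = 1]) (simp_all only: complex_cnj_diff[symmetric] complex_mod_cnj mult_1, simp_all)

lemma AC_on_bounded:
  assumes "AC_on a b f"
  obtains B where "B > 0" "\<And>x. x \<in> {a..b} \<Longrightarrow> cmod (f x) \<le> B"
proof -
  have "bounded (f ` {a..b})"
    by (rule compact_imp_bounded[OF compact_continuous_image[OF AC_on_continuous[OF assms] compact_Icc]])
  then show ?thesis using that by (auto simp: bounded_pos)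
qed

lemma AC_on_mult:
  assumes "AC_on a b f" "AC_on a b g" shows "AC_on a b (\<lambda>x. f x * g x)"
proof -
  obtain B1 where B1: "B1 > 0" "\<And>x. x \<in> {a..b} \<Longrightarrow> cmod (f x) \<le> B1" using AC_on_bounded[OF assms(1)] by metis
  obtain B2 where B2: "B2 > 0" "\<And>x. x \<in> {a..b} \<Longrightarrow> cmod (g x) \<le> B2" using AC_on_bounded[OF assms(2)] by metis
  show ?thesis
  proof (rule AC_on_dominated2[OF assms, of "B1 + B2"])
    fix x y assume xy: "a \<le> x" "x \<le> y" "y \<le> b"
    have "f y * g y - f x * g x = (f y - f x) * g y + f x * (g y - g x)" by (simp add: algebra_simps)
    then have "cmod (f y * g y - f x * g x) \<le> cmod (f y - f x) * cmod (g y) + cmod (f x) * cmod (g y - g x)"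
      by (metis norm_mult norm_triangle_ineq)
    also have "\<dots> \<le> cmod (f y - f x) * (B1 + B2) + (B1 + B2) * cmod (g y - g x)"
      using B1(1) B1(2)[of x] B2(1) B2(2)[of y] xy by (intro add_mono mult_mono) auto
    finally show "cmod (f y * g y - f x * g x) \<le> (B1 + B2) * (cmod (f y - f x) + cmod (g y - g x))"
      by (simp add: algebra_simps)
  qed (use B1 B2 in auto)
qed

text \<open>Inversion is Lipschitz with constant \<open>1 / c^2\<close> on the set where the modulus
  is at least \<open>c\<close>.\<close>

lemma AC_on_inverse:
  assumes "AC_on a b f" "c > 0" "\<And>x. x \<in> {a..b} \<Longrightarrow> c \<le> cmod (f x)"
  shows "AC_on a b (\<lambda>x. inverse (f x))"
proof (rule AC_on_dominated[OF assms(1), of "inverse (c * c)"])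
  fix x y assume xy: "a \<le> x" "x \<le> y" "y \<le> b"
  have c: "c \<le> cmod (f x)" "c \<le> cmod (f y)" using assms(3) xy by auto
  then have nz: "f x \<noteq> 0" "f y \<noteq> 0" using assms(2) by auto
  have "cmod (inverse (f y) - inverse (f x)) = cmod (f y - f x) * inverse (cmod (f y) * cmod (f x))"
    using nz by (simp add: inverse_diff_inverse norm_mult norm_inverse norm_minus_commute)
  also have "\<dots> \<le> cmod (f y - f x) * inverse (c * c)"
    using c assms(2) by (intro mult_left_mono le_imp_inverse_le mult_mono) auto
  finally show "cmod (inverse (f y) - inverse (f x)) \<le> inverse (c * c) * cmod (f y - f x)"
    by (simp add: mult.commute)
qed (use assms in auto)

section \<open>Variation and the fundamental theorem of calculus\<close>

definition variation_sums :: "(real \<Rightarrow> complex) \<Rightarrow> real \<Rightarrow> real \<Rightarrow> real set" where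
  "variation_sums f c d = {\<Sum>i\<in>I. cmod (f (v i) - f (u i)) | (I :: nat set) u v. nonoverlap I u v c d}"

definition variation :: "(real \<Rightarrow> complex) \<Rightarrow> real \<Rightarrow> real \<Rightarrow> real" where
  "variation f c d = Sup (variation_sums f c d)"

lemma variation_sumsI:
  assumes "nonoverlap (I :: 'i set) u v c d"
  shows "(\<Sum>i\<in>I. cmod (f (v i) - f (u i))) \<in> variation_sums f c d"
proof -
  obtain h where h: "bij_betw h {..<card I} I" "nonoverlap {..<card I} (u \<circ> h) (v \<circ> h) c d"
    using nonoverlap_enum[OF assms] .
  have "(\<Sum>i<card I. cmod (f ((v \<circ> h) i) - f ((u \<circ> h) i))) = (\<Sum>i\<in>I. cmod (f (v i) - f (u i)))"
    using sum.reindex_bij_betw[OF h(1), of "\<lambda>i. cmod (f (v i) - f (u i))"] by simp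
  then show ?thesis using h(2) unfolding variation_sums_def by force
qed

lemma variation_sums_nonempty: "variation_sums f c d \<noteq> {}"
  using variation_sumsI[of "{} :: nat set" undefined undefined c d f] by (auto simp: nonoverlap_def)

text \<open>Half-open intervals remain disjoint when neighbours share an endpoint, so lengths add up
  as Lebesgue measures.\<close>

lemma sum_nonoverlap_length_le:
  assumes "nonoverlap I u v a b" "a \<le> b"
  shows "(\<Sum>i\<in>I. v i - u i) \<le> b - a"
proof -
  have fin: "finite I" using assms by (simp add: nonoverlap_def)
  have disj: "disjoint_family_on (\<lambda>i. {u i<..v i}) I"
    unfolding disjoint_family_on_def
  proof (intro ballI impI)
    fix i j assume "i \<in> I" "j \<in> I" "i \<noteq> j"
    then have "v i \<le> u j \<or> v j \<le> u i" using assms(1) by (auto simp: nonoverlap_def)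
    then show "{u i<..v i} \<inter> {u j<..v j} = {}" by auto
  qed
  have "(\<Sum>i\<in>I. v i - u i) = (\<Sum>i\<in>I. measure lborel {u i<..v i})"
    using assms(1) by (intro sum.cong) (auto simp: nonoverlap_def)
  also have "\<dots> = measure lborel (\<Union>i\<in>I. {u i<..v i})"
    using assms(1) by (intro measure_finite_Union[symmetric] fin disj) (auto simp: nonoverlap_def)
  also have "\<dots> \<le> measure lborel {a<..b}"
    using assms by (intro measure_mono_fmeasurable) (auto simp: nonoverlap_def fmeasurable_def intro!: sets.finite_UN fin)
  also have "\<dots> = b - a" using assms(2) by simp
  finally show ?thesis .
qed

text \<open>Each interval is clipped at \<open>d\<close> by \<open>min\<close> and
  \<open>max\<close>. The increment of \<open>f\<close> splits exactly, because the values at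
  \<open>min (v i) d\<close> and \<open>max (v i) d\<close> add up to \<open>f (v i) + f d\<close>,
  and \<open>f d\<close> cancels.\<close>

lemma variation_sums_split:
  assumes "s \<in> variation_sums f c e" "c \<le> d" "d \<le> e"
  obtains s1 s2 where "s1 \<in> variation_sums f c d" "s2 \<in> variation_sums f d e" "s \<le> s1 + s2"
proof -
  obtain I :: "nat set" and u v where no: "nonoverlap I u v c e" and s: "s = (\<Sum>i\<in>I. cmod (f (v i) - f (u i)))"
    using assms(1) unfolding variation_sums_def by auto
  have le: "cmod (f (v i) - f (u i)) \<le> cmod (f (min (v i) d) - f (min (u i) d)) + cmod (f (max (v i) d) - f (max (u i) d))"
    if "i \<in> I" for i
  proof -
    have uv: "u i \<le> v i" using no that by (auto simp: nonoverlap_def)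
    have "f (v i) - f (u i) = (f (min (v i) d) - f (min (u i) d)) + (f (max (v i) d) - f (max (u i) d))"
      using uv by (auto simp: min_def max_def)
    then show ?thesis by (metis norm_triangle_ineq)
  qed
  have no1: "nonoverlap I (\<lambda>i. min (u i) d) (\<lambda>i. min (v i) d) c d"
    using no assms(2) unfolding nonoverlap_def by fastforce
  have no2: "nonoverlap I (\<lambda>i. max (u i) d) (\<lambda>i. max (v i) d) d e"
    using no assms(3) unfolding nonoverlap_def by fastforce
  show ?thesis
    by (rule that[OF variation_sumsI[OF no1] variation_sumsI[OF no2]])
       (use le in \<open>auto simp: s simp flip: sum.distrib intro!: sum_mono\<close>)
qed

text \<open>Take the \<open>\<delta>\<close> that belongs to 1. Every further stretch of length
  \<open>\<delta> / 2\<close> adds less than 1 to any variation sum, so induction on the number of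
  stretches bounds them all.\<close>

lemma AC_on_bounded_variation:
  assumes "AC_on a b f" shows "bdd_above (variation_sums f a b)"
proof -
  obtain \<delta> where \<delta>: "\<delta> > 0" "\<And>(I :: nat set) u v. nonoverlap I u v a b \<Longrightarrow>
      (\<Sum>i\<in>I. v i - u i) < \<delta> \<Longrightarrow> (\<Sum>i\<in>I. cmod (f (v i) - f (u i))) < 1"
    using AC_on_family[OF assms zero_less_one] by metis
  have *: "s \<le> real n" if "s \<in> variation_sums f a c" "a \<le> c" "c \<le> b" "c \<le> a + real n * (\<delta> / 2)" for n c s
    using that
  proof (induction n arbitrary: c s)
    case 0
    then have "c = a" by simp
    with 0 obtain I :: "nat set" and u v where no: "nonoverlap I u v a a" and s: "s = (\<Sum>i\<in>I. cmod (f (v i) - f (u i)))"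
      unfolding variation_sums_def by auto
    have "v i = u i" if "i \<in> I" for i using no that by (force simp: nonoverlap_def)
    then have "s = 0" by (simp add: s)
    then show ?case by simp
  next
    case (Suc n)
    \<comment> \<open>Half of \<open>\<delta>\<close> is used since absolute continuity asks for a
      total length strictly below \<open>\<delta>\<close>.\<close>
    define c' where "c' = max a (c - \<delta> / 2)"
    have c': "a \<le> c'" "c' \<le> c" "c - c' < \<delta>" "c' \<le> a + real n * (\<delta> / 2)"
      using Suc.prems \<delta>(1) by (auto simp: c'_def algebra_simps add_divide_distrib)
    obtain s1 s2 where s12: "s1 \<in> variation_sums f a c'" "s2 \<in> variation_sums f c' c" "s \<le> s1 + s2"
      using variation_sums_split[OF Suc.prems(1) c'(1,2)] .
    have "s1 \<le> real n" using Suc.IH[OF s12(1)] c' Suc.prems by simp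
    moreover have "s2 < 1"
    proof -
      obtain I :: "nat set" and u v where no: "nonoverlap I u v c' c" and s2: "s2 = (\<Sum>i\<in>I. cmod (f (v i) - f (u i)))"
        using s12(2) unfolding variation_sums_def by auto
      have "nonoverlap I u v a b" using no c' Suc.prems unfolding nonoverlap_def by fastforce
      moreover have "(\<Sum>i\<in>I. v i - u i) < \<delta>" using sum_nonoverlap_length_le[OF no c'(2)] c'(3) by simp
      ultimately show ?thesis unfolding s2 by (rule \<delta>(2))
    qed
    ultimately show ?case using s12(3) by simp
  qed
  show ?thesis
  proof (cases "a \<le> b")
    case True
    obtain n where "(b - a) / (\<delta> / 2) \<le> real n" using real_arch_simple by blast
    then have "b \<le> a + real n * (\<delta> / 2)" using \<delta>(1) by (simp add: field_simps)
    then show ?thesis using * True by (intro bdd_aboveI[of _ "real n"]) auto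
  next
    case False
    have "s = 0" if "s \<in> variation_sums f a b" for s
      using that False unfolding variation_sums_def nonoverlap_def by (fastforce intro!: sum.neutral)
    then show ?thesis by (intro bdd_aboveI[of _ 0]) auto
  qed
qed

lemma variation_sums_le_variation:
  "AC_on a b f \<Longrightarrow> s \<in> variation_sums f a b \<Longrightarrow> s \<le> variation f a b"
  unfolding variation_def by (rule cSup_upper) (auto intro: AC_on_bounded_variation)

lemma variation_triangle:
  assumes "AC_on a b f" "a \<le> c" "c \<le> d" "d \<le> b"
  shows "variation f a d \<le> variation f a c + variation f c d"
  unfolding variation_def[of f a d]
proof (rule cSup_least[OF variation_sums_nonempty])
  fix s assume "s \<in> variation_sums f a d"
  then obtain s1 s2 where s12: "s1 \<in> variation_sums f a c" "s2 \<in> variation_sums f c d" "s \<le> s1 + s2"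
    using variation_sums_split assms by metis
  have "AC_on a c f" "AC_on c d f" using AC_on_subinterval[OF assms(1)] assms by auto
  then show "s \<le> variation f a c + variation f c d"
    using variation_sums_le_variation s12 by (meson add_mono order_trans)
qed

lemma variation_increment:
  assumes "AC_on a b f" "a \<le> c" "c \<le> d" "d \<le> b"
  shows "variation f a c + cmod (f d - f c) \<le> variation f a d"
proof -
  have ac: "AC_on a d f" using AC_on_subinterval[OF assms(1)] assms by auto
  have "variation f a c \<le> variation f a d - cmod (f d - f c)"
    unfolding variation_def[of f a c]
  proof (rule cSup_least[OF variation_sums_nonempty])
    fix s assume "s \<in> variation_sums f a c"
    then obtain I :: "nat set" and u v where no: "nonoverlap I u v a c" and s: "s = (\<Sum>i\<in>I. cmod (f (v i) - f (u i)))"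
      unfolding variation_sums_def by auto
    \<comment> \<open>The interval from \<open>c\<close> to \<open>d\<close> is appended to the
      family; the index \<open>None\<close> is reserved for it.\<close>
    define u' where "u' = case_option c u"
    define v' where "v' = case_option d v"
    have fin: "finite I" using no by (simp add: nonoverlap_def)
    have "nonoverlap (insert None (Some ` I)) u' v' a d"
      using no assms unfolding nonoverlap_def u'_def v'_def by fastforce
    from variation_sums_le_variation[OF ac variation_sumsI[OF this]]
    have "(\<Sum>i\<in>insert None (Some ` I). cmod (f (v' i) - f (u' i))) \<le> variation f a d" .
    also have "(\<Sum>i\<in>insert None (Some ` I). cmod (f (v' i) - f (u' i))) = cmod (f d - f c) + s"
      using fin by (subst sum.insert) (auto simp: u'_def v'_def s sum.reindex)
    finally show "s \<le> variation f a d - cmod (f d - f c)" by simp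
  qed
  then show ?thesis by simp
qed

text \<open>Inside each given interval a nearly optimal subfamily is chosen. The union of these
  subfamilies is no longer in total length than the original family, so absolute continuity of
  \<open>f\<close> bounds its sum, which is nearly the sum of the variations.\<close>

lemma AC_on_variation:
  assumes "AC_on a b f"
  shows "AC_on a b (\<lambda>x. complex_of_real (variation f a x))"
proof (rule AC_onI)
  fix \<epsilon> :: real assume "\<epsilon> > 0"
  then have e2: "\<epsilon> / 2 > 0" by simp
  obtain \<delta> where \<delta>: "\<delta> > 0" "\<And>(I :: (nat \<times> nat) set) u v. nonoverlap I u v a b \<Longrightarrow>
      (\<Sum>i\<in>I. v i - u i) < \<delta> \<Longrightarrow> (\<Sum>i\<in>I. cmod (f (v i) - f (u i))) < \<epsilon> / 2"
    using AC_on_family[OF assms e2] by metis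
  have "(\<Sum>i\<in>I. cmod (of_real (variation f a (v i)) - of_real (variation f a (u i)))) < \<epsilon>"
    if no: "nonoverlap I u v a b" and len: "(\<Sum>i\<in>I. v i - u i) < \<delta>" for I :: "nat set" and u v
  proof -
    have fin: "finite I" using no by (simp add: nonoverlap_def)
    \<comment> \<open>The approximation errors of all intervals add up to at most
      \<open>\<epsilon> / 2\<close>; the \<open>+ 1\<close> covers the empty family.\<close>
    define e where "e = \<epsilon> / (2 * (real (card I) + 1))"
    have "e > 0" using \<open>\<epsilon> > 0\<close> by (simp add: e_def)
    have uv: "a \<le> u i" "u i \<le> v i" "v i \<le> b" if "i \<in> I" for i using no that by (auto simp: nonoverlap_def)
    have "\<exists>J u' v'. nonoverlap (J :: nat set) u' v' (u i) (v i) \<and>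
        variation f (u i) (v i) - e < (\<Sum>j\<in>J. cmod (f (v' j) - f (u' j)))" for i
    proof -
      have "\<exists>s\<in>variation_sums f (u i) (v i). variation f (u i) (v i) - e < s"
        using less_cSupD[OF variation_sums_nonempty, of "variation f (u i) (v i) - e" f "u i" "v i"] \<open>e > 0\<close>
        unfolding variation_def by auto
      then show ?thesis unfolding variation_sums_def by blast
    qed
    then obtain J u' v' where J: "\<And>i. nonoverlap (J i :: nat set) (u' i) (v' i) (u i) (v i)"
      and Js: "\<And>i. variation f (u i) (v i) - e < (\<Sum>j\<in>J i. cmod (f (v' i j) - f (u' i j)))"
      by metis
    have finJ: "finite (J i)" for i using J[of i] by (simp add: nonoverlap_def)
    define U where "U = (\<lambda>(i,j). u' i j)"
    define V where "V = (\<lambda>(i,j). v' i j)"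
    have inn: "u i \<le> u' i j" "u' i j \<le> v' i j" "v' i j \<le> v i" if "j \<in> J i" for i j
      using J[of i] that by (auto simp: nonoverlap_def)
    have noS: "nonoverlap (Sigma I J) U V a b"
      unfolding nonoverlap_def
    proof (intro conjI ballI impI)
      show "finite (Sigma I J)" using fin finJ by auto
      fix k assume k: "k \<in> Sigma I J"
      then obtain i j where ij: "k = (i, j)" "i \<in> I" "j \<in> J i" by auto
      show "a \<le> U k" "U k \<le> V k" "V k \<le> b"
        using uv[OF ij(2)] inn[OF ij(3)] by (auto simp: ij U_def V_def)
      fix k' assume k': "k' \<in> Sigma I J" "k \<noteq> k'"
      then obtain i' j' where ij': "k' = (i', j')" "i' \<in> I" "j' \<in> J i'" by auto
      show "V k \<le> U k' \<or> V k' \<le> U k"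
      proof (cases "i = i'")
        case True
        then show ?thesis using J[of i] ij ij' k'(2) by (auto simp: nonoverlap_def U_def V_def)
      next
        case False
        then have "v i \<le> u i' \<or> v i' \<le> u i" using no ij ij' by (auto simp: nonoverlap_def)
        then show ?thesis using inn[OF ij(3)] inn[OF ij'(3)] by (auto simp: ij ij' U_def V_def)
      qed
    qed
    have "(\<Sum>k\<in>Sigma I J. V k - U k) = (\<Sum>i\<in>I. \<Sum>j\<in>J i. v' i j - u' i j)"
      using fin finJ by (subst sum.Sigma) (auto simp: U_def V_def intro!: sum.cong)
    also have "\<dots> \<le> (\<Sum>i\<in>I. v i - u i)"
      using sum_nonoverlap_length_le[OF J] uv by (intro sum_mono) auto
    finally have "(\<Sum>k\<in>Sigma I J. cmod (f (V k) - f (U k))) < \<epsilon> / 2"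
      using len by (intro \<delta>(2)[OF noS]) auto
    moreover have "(\<Sum>k\<in>Sigma I J. cmod (f (V k) - f (U k))) = (\<Sum>i\<in>I. \<Sum>j\<in>J i. cmod (f (v' i j) - f (u' i j)))"
      using fin finJ by (subst sum.Sigma) (auto simp: U_def V_def intro!: sum.cong)
    ultimately have *: "(\<Sum>i\<in>I. \<Sum>j\<in>J i. cmod (f (v' i j) - f (u' i j))) < \<epsilon> / 2" by simp
    have "cmod (of_real (variation f a (v i)) - of_real (variation f a (u i))) \<le>
        (\<Sum>j\<in>J i. cmod (f (v' i j) - f (u' i j))) + e" if "i \<in> I" for i
    proof -
      have "variation f a (v i) \<le> variation f a (u i) + variation f (u i) (v i)"
        using variation_triangle[OF assms] uv[OF that] by auto
      moreover have "variation f a (u i) + cmod (f (v i) - f (u i)) \<le> variation f a (v i)"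
        using variation_increment[OF assms] uv[OF that] by auto
      then have "variation f a (u i) \<le> variation f a (v i)" using norm_ge_zero[of "f (v i) - f (u i)"] by linarith
      ultimately show ?thesis using Js[of i] by (simp flip: of_real_diff)
    qed
    then have "(\<Sum>i\<in>I. cmod (of_real (variation f a (v i)) - of_real (variation f a (u i)))) \<le>
        (\<Sum>i\<in>I. (\<Sum>j\<in>J i. cmod (f (v' i j) - f (u' i j))) + e)" by (rule sum_mono)
    also have "\<dots> = (\<Sum>i\<in>I. \<Sum>j\<in>J i. cmod (f (v' i j) - f (u' i j))) + real (card I) * e"
      by (simp add: sum.distrib)
    also have "real (card I) * e \<le> \<epsilon> / 2"
      using \<open>\<epsilon> > 0\<close> by (simp add: e_def field_simps)
    finally show ?thesis using * by simp
  qed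
  then show "\<exists>\<delta>>0. \<forall>(I :: nat set) u v. nonoverlap I u v a b \<longrightarrow> (\<Sum>i\<in>I. v i - u i) < \<delta> \<longrightarrow>
      (\<Sum>i\<in>I. cmod (of_real (variation f a (v i)) - of_real (variation f a (u i)))) < \<epsilon>"
    using \<delta>(1) by blast
qed

section \<open>Radon-Nikodym densities of absolutely continuous functions\<close>

text \<open>Outer regularity puts the null set into an open \<open>U\<close> of measure below
  \<open>\<delta>\<close>. Nonoverlapping intervals inside \<open>U\<close> that cover it on
  \<open>{a..b}\<close> have total length below \<open>\<delta>\<close>, hence small total increment
  of \<open>F\<close>, which is their Stieltjes measure.\<close>

lemma interval_measure_AC_null:
  fixes F :: "real \<Rightarrow> real"
  assumes "a < b" and mono: "\<And>x y. x \<le> y \<Longrightarrow> F x \<le> F y" and cont: "continuous_on UNIV F"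
    and AC: "AC_on a b (\<lambda>x. complex_of_real (F x))" and A: "A \<in> null_sets lborel"
  shows "emeasure (interval_measure F) (A \<inter> {a..b}) = 0"
proof -
  let ?N = "interval_measure F"
  have [measurable]: "A \<in> sets borel" using A by auto
  have "emeasure ?N (A \<inter> {a..b}) \<le> ennreal \<epsilon>" if pos: "\<epsilon> > 0" for \<epsilon>
  proof -
    obtain \<delta> where \<delta>: "\<delta> > 0" "\<And>(I :: real set set) u v. nonoverlap I u v a b \<Longrightarrow>
        (\<Sum>i\<in>I. v i - u i) < \<delta> \<Longrightarrow> (\<Sum>i\<in>I. cmod (complex_of_real (F (v i)) - of_real (F (u i)))) < \<epsilon>"
      using AC_on_family[OF AC pos] by metis
    obtain U where U: "open U" "A \<subseteq> U" "emeasure lborel (U - A) < ennreal \<delta>"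
      using outer_regular_lborel[of A \<delta>] \<delta>(1) by auto
    have lU: "emeasure lborel U < ennreal \<delta>"
      using U emeasure_Diff_null_set[OF A, of U] by simp
    \<comment> \<open>On \<open>U\<close> the gauge confines the covering intervals to
      \<open>U\<close>; the value \<open>UNIV\<close> elsewhere only completes it to a gauge on the
      whole line.\<close>
    define g where "g = (\<lambda>x. if x \<in> U then U else UNIV)"
    have "gauge g" using U(1) by (auto simp: gauge_def g_def)
    obtain D where D: "countable D" "\<Union>D \<subseteq> cbox a b"
        "\<And>K. K \<in> D \<Longrightarrow> interior K \<noteq> {} \<and> (\<exists>c d. K = cbox c d)"
        "pairwise (\<lambda>A B. interior A \<inter> interior B = {}) D"
        "\<And>K. K \<in> D \<Longrightarrow> \<exists>x \<in> (A \<inter> {a..b}) \<inter> K. K \<subseteq> g x" "A \<inter> {a..b} \<subseteq> \<Union>D"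
    proof (rule covering_lemma[of "A \<inter> {a..b}" a b g])
    qed (use \<open>gauge g\<close> \<open>a < b\<close> in auto)
    define u v where "u = (Inf :: real set \<Rightarrow> real)" and "v = (Sup :: real set \<Rightarrow> real)"
    have K: "K = {u K..v K}" "u K < v K" "a \<le> u K" "v K \<le> b" "K \<subseteq> U" if "K \<in> D" for K
    proof -
      obtain c d where cd: "K = {c..d}" using D(3)[OF \<open>K \<in> D\<close>] by auto
      then have "c < d" using D(3)[OF \<open>K \<in> D\<close>] by auto
      then have "u K = c" "v K = d" using cd by (auto simp: u_def v_def)
      then show "K = {u K..v K}" "u K < v K" using cd \<open>c < d\<close> by auto
      have "{c..d} \<subseteq> {a..b}" using Union_upper[OF that] D(2) cd by (metis box_real(2) order_trans)
      then show "a \<le> u K" "v K \<le> b" using \<open>c < d\<close> \<open>u K = c\<close> \<open>v K = d\<close> by auto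
      show "K \<subseteq> U" using D(5)[OF that] U(2) by (auto simp: g_def split: if_splits)
    qed
    \<comment> \<open>Absolute continuity controls finite families only; the countable union is
      reached afterwards as an increasing limit.\<close>
    have fin_le: "emeasure ?N (\<Union>E) \<le> ennreal \<epsilon>" if E: "finite E" "E \<subseteq> D" for E
    proof -
      have no: "nonoverlap E u v a b"
        unfolding nonoverlap_def
      proof (intro conjI ballI impI)
        fix K assume "K \<in> E" then have KD: "K \<in> D" using E by auto
        show "a \<le> u K" "u K \<le> v K" "v K \<le> b" using K[OF KD] by auto
        fix L assume "L \<in> E" "K \<noteq> L" then have LD: "L \<in> D" using E by auto
        have "interior K \<inter> interior L = {}" using D(4) KD LD \<open>K \<noteq> L\<close> by (auto simp: pairwise_def)
        then have "{u K<..<v K} \<inter> {u L<..<v L} = {}"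
          by (subst (asm) K(1)[OF KD], subst (asm) K(1)[OF LD]) simp
        then have "{max (u K) (u L)<..<min (v K) (v L)} = {}" by auto
        then have "min (v K) (v L) \<le> max (u K) (u L)" by (simp add: greaterThanLessThan_empty_iff)
        then show "v K \<le> u L \<or> v L \<le> u K" using K(2)[OF KD] K(2)[OF LD] by linarith
      qed (use E in auto)
      have disj: "disjoint_family_on (\<lambda>K. {u K<..v K}) E"
        unfolding disjoint_family_on_def
      proof (intro ballI impI)
        fix K L assume "K \<in> E" "L \<in> E" "K \<noteq> L"
        then have "v K \<le> u L \<or> v L \<le> u K" using no by (auto simp: nonoverlap_def)
        then show "{u K<..v K} \<inter> {u L<..v L} = {}" by auto
      qed
      have "ennreal (\<Sum>K\<in>E. v K - u K) = (\<Sum>K\<in>E. emeasure lborel {u K<..v K})"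
        using no by (subst sum_ennreal[symmetric]) (auto simp: nonoverlap_def intro!: sum.cong)
      also have "\<dots> = emeasure lborel (\<Union>K\<in>E. {u K<..v K})"
        by (intro sum_emeasure disj E) auto
      also have "\<dots> \<le> emeasure lborel U"
      proof (rule emeasure_mono)
        show "(\<Union>K\<in>E. {u K<..v K}) \<subseteq> U"
        proof
          fix x assume "x \<in> (\<Union>K\<in>E. {u K<..v K})"
          then obtain K where "K \<in> D" "x \<in> {u K..v K}" using E by auto
          then show "x \<in> U" using K(1)[of K] K(5)[of K] by auto
        qed
      qed (use U in auto)
      finally have "ennreal (\<Sum>K\<in>E. v K - u K) < ennreal \<delta>" using lU by simp
      moreover have "0 \<le> (\<Sum>K\<in>E. v K - u K)" using no by (intro sum_nonneg) (auto simp: nonoverlap_def)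
      ultimately have "(\<Sum>K\<in>E. v K - u K) < \<delta>" by (simp add: ennreal_less_iff)
      from \<delta>(2)[OF no this] have lt: "(\<Sum>K\<in>E. \<bar>F (v K) - F (u K)\<bar>) < \<epsilon>"
        by (simp flip: of_real_diff)
      have "emeasure ?N (\<Union>E) = emeasure ?N (\<Union>K\<in>E. {u K..v K})"
        using K(1) E by (intro arg_cong[where f = "emeasure ?N"]) auto
      also have "\<dots> \<le> (\<Sum>K\<in>E. emeasure ?N {u K..v K})"
        by (intro emeasure_subadditive_finite E) auto
      also have "\<dots> = (\<Sum>K\<in>E. ennreal (F (v K) - F (u K)))"
        using no by (intro sum.cong) (auto simp: nonoverlap_def intro!: emeasure_interval_measure_Icc mono cont)
      also have "\<dots> = ennreal (\<Sum>K\<in>E. F (v K) - F (u K))"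
        using no by (intro sum_ennreal) (auto simp: nonoverlap_def intro!: mono)
      also have "\<dots> \<le> ennreal \<epsilon>"
        using lt sum_mono[of E "\<lambda>K. F (v K) - F (u K)", OF abs_ge_self] by (intro ennreal_leI) linarith
      finally show ?thesis .
    qed
    have measD: "\<Union>E \<in> sets ?N" if "E \<subseteq> D" for E
    proof (rule sets.countable_Union)
      show "countable E" using that D(1) countable_subset by blast
      show "E \<subseteq> sets ?N"
      proof
        fix K assume "K \<in> E"
        then have "K = {u K..v K}" using K(1) that by auto
        then show "K \<in> sets ?N" by (metis atLeastAtMost_borel sets_interval_measure)
      qed
    qed
    have "emeasure ?N (\<Union>D) \<le> ennreal \<epsilon>"
    proof (cases "D = {}")
      case False
      define e where "e = from_nat_into D"
      have e: "range e = D" unfolding e_def using False D(1) by (rule range_from_nat_into)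
      have "\<Union>D = (\<Union>n. \<Union>(e ` {..n}))" using e by auto
      also have "emeasure ?N \<dots> = (SUP n. emeasure ?N (\<Union>(e ` {..n})))"
      proof (rule SUP_emeasure_incseq[symmetric])
        show "range (\<lambda>n. \<Union>(e ` {..n})) \<subseteq> sets ?N" using e by (intro image_subsetI measD) blast
        show "incseq (\<lambda>n. \<Union>(e ` {..n}))" by (intro incseq_SucI Union_mono image_mono) simp
      qed
      also have "\<dots> \<le> ennreal \<epsilon>" using e by (intro SUP_least fin_le) auto
      finally show ?thesis .
    qed simp
    then show ?thesis
      using emeasure_mono[OF D(6) measD[OF order_refl]] by (rule order_trans[rotated])
  qed
  then show ?thesis
    by (metis ennreal_0 ennreal_le_epsilon le_zero_eq add_0 ennreal_0 dense)
qed

lemma mono_AC_density: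
  fixes F :: "real \<Rightarrow> real"
  assumes "a < b" and mono: "\<And>x y. x \<le> y \<Longrightarrow> F x \<le> F y" and cont: "continuous_on UNIV F"
    and AC: "AC_on a b (\<lambda>x. complex_of_real (F x))"
  obtains h :: "real \<Rightarrow> real" where "h absolutely_integrable_on {a..b}"
    "\<And>x. x \<in> {a..b} \<Longrightarrow> (h has_integral F x - F a) {a..x}"
proof -
  let ?N = "interval_measure F"
  \<comment> \<open>The measure is cut down to \<open>{a..b}\<close> because absolute continuity of
    \<open>F\<close> is known only there.\<close>
  define N' where "N' = density ?N (indicator {a..b})"
  have setsN': "sets N' = sets lborel" by (simp add: N'_def)
  have N': "emeasure N' A = emeasure ?N (A \<inter> {a..b})" if "A \<in> sets borel" for A
    using that by (simp add: N'_def emeasure_restricted Int_commute)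
  have "absolutely_continuous lborel N'"
    unfolding absolutely_continuous_def
    using interval_measure_AC_null[OF assms] N' by (auto simp: null_sets_def setsN')
  then obtain f where [measurable]: "f \<in> borel_measurable lborel" and f: "density lborel f = N'"
    using sigma_finite_measure.Radon_Nikodym[OF sigma_finite_lborel _ setsN'] by blast
  have fx: "(\<integral>\<^sup>+t. f t * indicator {a..x} t \<partial>lborel) = ennreal (F x - F a)" if "x \<in> {a..b}" for x
  proof -
    have "(\<integral>\<^sup>+t. f t * indicator {a..x} t \<partial>lborel) = emeasure N' {a..x}"
      by (simp add: f[symmetric] emeasure_density)
    also have "\<dots> = emeasure ?N {a..x}" using that by (subst N') (auto intro!: arg_cong[where f = "emeasure ?N"])
    also have "\<dots> = ennreal (F x - F a)" using that by (intro emeasure_interval_measure_Icc mono cont) auto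
    finally show ?thesis .
  qed
  have "AE t in lborel. f t * indicator {a..b} t \<noteq> \<infinity>"
    using fx[of b] \<open>a < b\<close> by (intro nn_integral_PInf_AE) auto
  then have fin: "AE t in lborel. t \<in> {a..b} \<longrightarrow> f t = ennreal (enn2real (f t))"
    by eventually_elim (auto simp: indicator_def less_top)
  \<comment> \<open>\<open>enn2real\<close> sends an infinite density value to 0; by
    \<open>fin\<close> this changes the density on \<open>{a..b}\<close> only on a null set.\<close>
  define h where "h t = enn2real (f t)" for t
  have hint: "(h has_integral F x - F a) {a..x}" if x: "x \<in> {a..b}" for x
  proof -
    have "(\<integral>\<^sup>+t. ennreal (h t * indicator {a..x} t) \<partial>lborel) = (\<integral>\<^sup>+t. f t * indicator {a..x} t \<partial>lborel)"
      by (rule nn_integral_cong_AE, use fin in eventually_elim)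
         (use x in \<open>auto simp: h_def indicator_def\<close>)
    then have "((\<lambda>t. h t * indicator {a..x} t) has_integral F x - F a) UNIV"
      using x mono by (intro nn_integral_has_integral) (auto simp: fx h_def)
    moreover have "(\<lambda>t. h t * indicator {a..x} t) = (\<lambda>t. if t \<in> {a..x} then h t else 0)" by auto
    ultimately show ?thesis by (simp only: has_integral_restrict_UNIV)
  qed
  have "h integrable_on {a..b}" using hint[of b] \<open>a < b\<close> by auto
  then have "h absolutely_integrable_on {a..b}"
    by (intro nonnegative_absolutely_integrable_1) (auto simp: h_def)
  then show ?thesis using hint that by blast
qed

lemma AC_on_eq_on:
  assumes "AC_on a b f" "\<And>x. x \<in> {a..b} \<Longrightarrow> g x = f x" shows "AC_on a b g"
  by (rule AC_on_dominated[OF assms(1), of 1]) (use assms(2) in auto)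

text \<open>Jordan decomposition: the variation \<open>V\<close> and \<open>W = V - \<phi>\<close>
  are both monotone and absolutely continuous, so each has a density, and \<open>\<phi>\<close> is
  their difference.\<close>

lemma AC_on_density_real:
  fixes \<phi> :: "real \<Rightarrow> real"
  assumes "a < b" "AC_on a b (\<lambda>x. complex_of_real (\<phi> x))"
  obtains g :: "real \<Rightarrow> real" where "g absolutely_integrable_on {a..b}"
    "\<And>x. x \<in> {a..b} \<Longrightarrow> (g has_integral \<phi> x - \<phi> a) {a..x}"
proof -
  define f where "f x = complex_of_real (\<phi> x)" for x
  have f: "AC_on a b f" using assms(2) by (simp add: f_def[abs_def])
  \<comment> \<open>Clamping to \<open>{a..b}\<close> extends \<open>V\<close> and \<open>W\<close>
    to functions that are monotone and continuous on the whole line, as the Stieltjes measure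
    requires.\<close>
  define c where "c x = max a (min b x)" for x
  have c: "c x \<in> {a..b}" "x \<le> y \<Longrightarrow> c x \<le> c y" for x y using \<open>a < b\<close> by (auto simp: c_def)
  have c_id: "c x = x" if "x \<in> {a..b}" for x using that by (auto simp: c_def)
  have ccont: "continuous_on UNIV c" unfolding c_def by (intro continuous_intros)
  define V where "V x = variation f a x" for x
  define W where "W x = V x - \<phi> x" for x
  have V: "AC_on a b (\<lambda>x. complex_of_real (V x))" unfolding V_def by (rule AC_on_variation[OF f])
  have W: "AC_on a b (\<lambda>x. complex_of_real (W x))" using AC_on_diff[OF V f] by (simp add: W_def f_def)
  have inc: "V x + \<bar>\<phi> y - \<phi> x\<bar> \<le> V y" if "a \<le> x" "x \<le> y" "y \<le> b" for x y
    using variation_increment[OF f that] by (simp add: V_def f_def flip: of_real_diff)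
  have mono: "V (c x) \<le> V (c y)" "W (c x) \<le> W (c y)" if "x \<le> y" for x y
    using inc[of "c x" "c y"] c(1)[of x] c(1)[of y] c(2)[OF that] by (auto simp: W_def)
  have cont: "continuous_on UNIV (\<lambda>x. h (c x))" if "AC_on a b (\<lambda>x. complex_of_real (h x))" for h
  proof -
    have "continuous_on {a..b} (\<lambda>x. Re (complex_of_real (h x)))"
      using AC_on_continuous[OF that] by (rule continuous_on_Re)
    then show ?thesis using c(1) by (intro continuous_on_compose2[OF _ ccont, of "{a..b}" h]) auto
  qed
  have ACc: "AC_on a b (\<lambda>x. complex_of_real (h (c x)))" if "AC_on a b (\<lambda>x. complex_of_real (h x))" for h
    by (rule AC_on_eq_on[OF that]) (simp add: c_id)
  obtain g1 where g1: "g1 absolutely_integrable_on {a..b}"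
    "\<And>x. x \<in> {a..b} \<Longrightarrow> (g1 has_integral V (c x) - V (c a)) {a..x}"
    using mono_AC_density[OF \<open>a < b\<close> mono(1) cont[OF V] ACc[OF V]] by blast
  obtain g2 where g2: "g2 absolutely_integrable_on {a..b}"
    "\<And>x. x \<in> {a..b} \<Longrightarrow> (g2 has_integral W (c x) - W (c a)) {a..x}"
    using mono_AC_density[OF \<open>a < b\<close> mono(2) cont[OF W] ACc[OF W]] by blast
  show ?thesis
  proof (rule that[of "\<lambda>x. g1 x - g2 x"])
    show "(\<lambda>x. g1 x - g2 x) absolutely_integrable_on {a..b}" using g1(1) g2(1) by (rule set_integral_diff)
    fix x assume x: "x \<in> {a..b}"
    then have "a \<in> {a..b}" by auto
    from has_integral_diff[OF g1(2)[OF x] g2(2)[OF x]]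
    show "((\<lambda>x. g1 x - g2 x) has_integral \<phi> x - \<phi> a) {a..x}"
      using c_id[OF x] c_id[OF \<open>a \<in> {a..b}\<close>] by (simp add: W_def)
  qed
qed

lemma AC_on_density:
  assumes "a < b" "AC_on a b f"
  obtains g :: "real \<Rightarrow> complex" where "g absolutely_integrable_on {a..b}"
    "\<And>x. x \<in> {a..b} \<Longrightarrow> (g has_integral f x - f a) {a..x}"
proof -
  obtain g1 where g1: "g1 absolutely_integrable_on {a..b}"
    "\<And>x. x \<in> {a..b} \<Longrightarrow> (g1 has_integral Re (f x) - Re (f a)) {a..x}"
    using AC_on_density_real[OF \<open>a < b\<close> AC_on_of_real_Re[OF assms(2)]] by blast
  obtain g2 where g2: "g2 absolutely_integrable_on {a..b}"
    "\<And>x. x \<in> {a..b} \<Longrightarrow> (g2 has_integral Im (f x) - Im (f a)) {a..x}"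
    using AC_on_density_real[OF \<open>a < b\<close> AC_on_of_real_Im[OF assms(2)]] by blast
  show ?thesis
  proof (rule that[of "\<lambda>x. Complex (g1 x) (g2 x)"])
    show "(\<lambda>x. Complex (g1 x) (g2 x)) absolutely_integrable_on {a..b}"
      using g1(1) g2(1) by (subst absolutely_integrable_componentwise_iff) (auto simp: Basis_complex_def)
    fix x assume x: "x \<in> {a..b}"
    show "((\<lambda>x. Complex (g1 x) (g2 x)) has_integral f x - f a) {a..x}"
      using g1(2)[OF x] g2(2)[OF x] by (subst has_integral_componentwise_iff) (auto simp: Basis_complex_def)
  qed
qed

section \<open>Differentiation of indefinite integrals\<close>

lemma has_vector_derivative_from_sides:
  fixes f :: "real \<Rightarrow> 'a::real_normed_vector"
  assumes R: "\<And>e. e > 0 \<Longrightarrow> \<exists>d>0. \<forall>h. 0 < h \<and> h < d \<longrightarrow> norm ((f (x + h) - f x) /\<^sub>R h - D) < e"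
    and L: "\<And>e. e > 0 \<Longrightarrow> \<exists>d>0. \<forall>h. 0 < h \<and> h < d \<longrightarrow> norm ((f x - f (x - h)) /\<^sub>R h - D) < e"
  shows "(f has_vector_derivative D) (at x)"
  unfolding has_vector_derivative_def has_derivative_at_alt
proof (intro conjI allI impI)
  show "bounded_linear (\<lambda>h. h *\<^sub>R D)" by (rule bounded_linear_scaleR_left)
  fix e :: real assume "e > 0"
  obtain d1 where d1: "d1 > 0" "\<And>h. 0 < h \<Longrightarrow> h < d1 \<Longrightarrow> norm ((f (x + h) - f x) /\<^sub>R h - D) < e"
    using R[OF \<open>e > 0\<close>] by blast
  obtain d2 where d2: "d2 > 0" "\<And>h. 0 < h \<Longrightarrow> h < d2 \<Longrightarrow> norm ((f x - f (x - h)) /\<^sub>R h - D) < e"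
    using L[OF \<open>e > 0\<close>] by blast
  have scale: "norm (w - h *\<^sub>R D) \<le> e * h" if "h > 0" "norm (w /\<^sub>R h - D) < e" for w :: 'a and h
  proof -
    have "w - h *\<^sub>R D = h *\<^sub>R (w /\<^sub>R h - D)" using that by (simp add: scaleR_diff_right)
    then have "norm (w - h *\<^sub>R D) = h * norm (w /\<^sub>R h - D)" using that by simp
    also have "\<dots> \<le> h * e" using that by (intro mult_left_mono) auto
    finally show ?thesis by (simp add: mult.commute)
  qed
  show "\<exists>d>0. \<forall>y. norm (y - x) < d \<longrightarrow> norm (f y - f x - (y - x) *\<^sub>R D) \<le> e * norm (y - x)"
  proof (intro exI[of _ "min d1 d2"] conjI allI impI)
    fix y assume y: "norm (y - x) < min d1 d2"
    consider "y > x" | "y = x" | "y < x" by linarith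
    then show "norm (f y - f x - (y - x) *\<^sub>R D) \<le> e * norm (y - x)"
    proof cases
      case 1
      then show ?thesis using scale[of "y - x" "f y - f x"] d1(2)[of "y - x"] y by simp
    next
      case 3
      have "f y - f x - (y - x) *\<^sub>R D = - (f x - f y - (x - y) *\<^sub>R D)" by (simp add: algebra_simps)
      then have "norm (f y - f x - (y - x) *\<^sub>R D) = norm (f x - f y - (x - y) *\<^sub>R D)" by (metis norm_minus_cancel)
      then show ?thesis using scale[of "x - y" "f x - f y"] d2(2)[of "x - y"] y 3 by simp
    qed simp
  qed (use d1 d2 in auto)
qed

text \<open>\<open>integrable_ccontinuous_explicit\<close> controls forward difference quotients of
  an indefinite integral. Backward quotients are the forward ones of the reflected function, so the
  exceptional set is \<open>N1\<close> together with the reflection of \<open>N2\<close>.\<close>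

lemma AC_on_FTC:
  assumes "a < b" "AC_on a b f"
  obtains g :: "real \<Rightarrow> complex" and N where "g absolutely_integrable_on {a..b}" "negligible N"
    "\<And>x. x \<in> {a<..<b} - N \<Longrightarrow> (f has_vector_derivative g x) (at x)"
    "\<And>x y. a \<le> x \<Longrightarrow> x \<le> y \<Longrightarrow> y \<le> b \<Longrightarrow> (g has_integral f y - f x) {x..y}"
proof -
  obtain g where g: "g absolutely_integrable_on {a..b}"
    and gi: "\<And>x. x \<in> {a..b} \<Longrightarrow> (g has_integral f x - f a) {a..x}"
    using AC_on_density[OF assms] by blast
  have int: "(g has_integral f y - f x) {x..y}" if "a \<le> x" "x \<le> y" "y \<le> b" for x y
  proof -
    have "g integrable_on {x..y}"
      using integrable_subinterval_real[OF set_lebesgue_integral_eq_integral(1)[OF g], of x y] that by auto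
    then have "(g has_integral integral {x..y} g) {x..y}" by (rule integrable_integral)
    moreover have "(f x - f a) + integral {x..y} g = f y - f a"
      using has_integral_combine[OF that(1,2) gi[of x] calculation] gi[of y] that
      by (intro has_integral_unique[of g _ "{a..y}"]) auto
    then have "integral {x..y} g = f y - f x" by (simp add: algebra_simps)
    ultimately show ?thesis by simp
  qed
  \<comment> \<open>Extension by zero makes the function integrable over every compact interval,
    whether or not it lies in \<open>{a..b}\<close>, and so also after reflection.\<close>
  define G where "G x = (if x \<in> {a..b} then g x else 0)" for x
  have "G integrable_on UNIV"
    unfolding G_def integrable_restrict_UNIV by (rule set_lebesgue_integral_eq_integral(1)[OF g])
  then have Gi: "G integrable_on cbox c d" for c d by (rule integrable_on_subcbox) simp
  have Gr: "(\<lambda>x. G (- x)) integrable_on cbox c d" for c d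
    using Gi[of "-d" "-c"] Henstock_Kurzweil_Integration.integrable_reflect_real[where f = G and a = "-d" and b = "-c"] by simp
  obtain N1 where N1: "negligible N1" "\<And>x e. \<lbrakk>x \<notin> N1; 0 < e\<rbrakk> \<Longrightarrow> \<exists>d>0. \<forall>h. 0 < h \<and> h < d \<longrightarrow>
      norm (integral {x..x + h} G /\<^sub>R h - G x) < e"
    using integrable_ccontinuous_explicit[OF Gi] by auto
  obtain N2 where N2: "negligible N2" "\<And>x e. \<lbrakk>x \<notin> N2; 0 < e\<rbrakk> \<Longrightarrow> \<exists>d>0. \<forall>h. 0 < h \<and> h < d \<longrightarrow>
      norm (integral {x..x + h} (\<lambda>x. G (- x)) /\<^sub>R h - G (- x)) < e"
    using integrable_ccontinuous_explicit[OF Gr] by auto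
  have Gint: "integral {x..y} G = f y - f x" if "a \<le> x" "x \<le> y" "y \<le> b" for x y
  proof -
    have "integral {x..y} G = integral {x..y} g"
      by (rule integral_cong) (use that in \<open>auto simp: G_def\<close>)
    then show ?thesis using int[OF that] by (simp add: integral_unique)
  qed
  show ?thesis
  proof (rule that[OF g _ _ int])
    show "negligible (N1 \<union> uminus ` N2)"
    proof (intro negligible_Un N1(1))
      show "negligible (uminus ` N2)"
        by (rule negligible_differentiable_image_negligible[OF _ N2(1)]) (auto intro!: derivative_intros)
    qed
    fix x assume x: "x \<in> {a<..<b} - (N1 \<union> uminus ` N2)"
    then have xN: "x \<notin> N1" "- x \<notin> N2" "a < x" "x < b" by force+
    have Gx: "G x = g x" using xN by (simp add: G_def)
    show "(f has_vector_derivative g x) (at x)"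
    proof (rule has_vector_derivative_from_sides)
      fix e :: real assume "e > 0"
      obtain d where d: "d > 0" "\<forall>h. 0 < h \<and> h < d \<longrightarrow> norm (integral {x..x + h} G /\<^sub>R h - G x) < e"
        using N1(2)[OF xN(1) \<open>e > 0\<close>] by blast
      show "\<exists>d>0. \<forall>h. 0 < h \<and> h < d \<longrightarrow> norm ((f (x + h) - f x) /\<^sub>R h - g x) < e"
      proof (intro exI[of _ "min d (b - x)"] conjI allI impI)
        fix h assume "0 < h \<and> h < min d (b - x)"
        then show "norm ((f (x + h) - f x) /\<^sub>R h - g x) < e"
          using d(2)[rule_format, of h] Gint[of x "x + h"] xN Gx by simp
      qed (use d xN in auto)
      obtain d where d: "d > 0" "\<forall>h. 0 < h \<and> h < d \<longrightarrow>
          norm (integral {- x..- x + h} (\<lambda>x. G (- x)) /\<^sub>R h - G (- (- x))) < e"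
        using N2(2)[OF xN(2) \<open>e > 0\<close>] by blast
      show "\<exists>d>0. \<forall>h. 0 < h \<and> h < d \<longrightarrow> norm ((f x - f (x - h)) /\<^sub>R h - g x) < e"
      proof (intro exI[of _ "min d (x - a)"] conjI allI impI)
        fix h assume h: "0 < h \<and> h < min d (x - a)"
        have "integral {- x..- (x - h)} (\<lambda>x. G (- x)) = integral {x - h..x} G"
          by (rule Henstock_Kurzweil_Integration.integral_reflect_real[where f = G and a = "x - h" and b = x])
        then have "integral {- x..- x + h} (\<lambda>x. G (- x)) = f x - f (x - h)"
          using Gint[of "x - h" x] xN h by simp
        then show "norm ((f x - f (x - h)) /\<^sub>R h - g x) < e"
          using d(2)[rule_format, of h] h Gx by simp
      qed (use d xN in auto)
    qed
  qed
qed

section \<open>Integrated differential inequalities\<close>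

text \<open>The pointwise bound is required of every \<open>D\<close> that is a derivative of
  \<open>f\<close> at \<open>x\<close>. The caller need not exhibit a derivative: almost everywhere
  one exists by \<open>AC_on_FTC\<close>, and it is the density of \<open>f\<close>.\<close>

lemma AC_on_growth:
  assumes "a \<le> b" "AC_on a b f" "\<phi> integrable_on {a..b}" "negligible N"
    and D: "\<And>x D. x \<in> {a<..<b} - N \<Longrightarrow> (f has_vector_derivative D) (at x) \<Longrightarrow> \<phi> x \<le> Re D"
  shows "integral {a..b} \<phi> \<le> Re (f b) - Re (f a)"
proof (cases "a = b")
  case False
  with assms(1) have "a < b" by simp
  obtain g N' where g: "negligible N'" "\<And>x. x \<in> {a<..<b} - N' \<Longrightarrow> (f has_vector_derivative g x) (at x)"
    "(g has_integral f b - f a) {a..b}"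
    using AC_on_FTC[OF \<open>a < b\<close> assms(2)] \<open>a < b\<close> by (metis order_refl less_imp_le)
  have Reg: "((\<lambda>x. Re (g x)) has_integral Re (f b - f a)) {a..b}"
    using has_integral_Re[OF g(3)] .
  define S where "S = N \<union> N' \<union> {a, b}"
  have S: "negligible S" using assms(4) g(1) by (simp add: S_def negligible_Un)
  \<comment> \<open>Changing \<open>\<phi>\<close> on a null set preserves its integral and makes
    the comparison with \<open>Re (g x)\<close> valid at every point of the interval.\<close>
  define \<psi> where "\<psi> x = (if x \<in> S then Re (g x) else \<phi> x)" for x
  have "(\<psi> has_integral integral {a..b} \<phi>) {a..b}"
    by (rule has_integral_spike[OF S _ integrable_integral[OF assms(3)]]) (simp add: \<psi>_def)
  then have "integral {a..b} \<phi> \<le> Re (f b - f a)"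
    by (rule has_integral_le[OF _ Reg]) (auto simp: \<psi>_def S_def intro!: D g(2))
  then show ?thesis by simp
qed simp

lemma AC_on_increment_le:
  assumes "a \<le> b" "AC_on a b f" "\<phi> integrable_on {a..b}" "negligible N"
    and D: "\<And>x D. x \<in> {a<..<b} - N \<Longrightarrow> (f has_vector_derivative D) (at x) \<Longrightarrow> cmod D \<le> \<phi> x"
  shows "cmod (f b - f a) \<le> integral {a..b} \<phi>"
proof (cases "a = b")
  case False
  with assms(1) have "a < b" by simp
  obtain g N' where g: "negligible N'" "\<And>x. x \<in> {a<..<b} - N' \<Longrightarrow> (f has_vector_derivative g x) (at x)"
    "(g has_integral f b - f a) {a..b}"
    using AC_on_FTC[OF \<open>a < b\<close> assms(2)] \<open>a < b\<close> by (metis order_refl less_imp_le)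
  define S where "S = N \<union> N' \<union> {a, b}"
  have S: "negligible S" using assms(4) g(1) by (simp add: S_def negligible_Un)
  define \<psi> where "\<psi> x = (if x \<in> S then cmod (g x) else \<phi> x)" for x
  have \<psi>: "(\<psi> has_integral integral {a..b} \<phi>) {a..b}"
    by (rule has_integral_spike[OF S _ integrable_integral[OF assms(3)]]) (simp add: \<psi>_def)
  have "cmod (integral {a..b} g) \<le> integral {a..b} \<psi>"
    by (rule integral_norm_bound_integral) (use g(3) \<psi> in \<open>auto simp: \<psi>_def S_def intro!: D g(2)\<close>)
  then show ?thesis using \<psi> g(3) by (simp add: integral_unique)
qed simp

section \<open>Exceptional sets, and the link between \<open>dR\<close> and genuine
  derivatives\<close>

lemma AE_lebesgue_on_negligible:
  assumes "S \<in> sets lebesgue" "AE x in lebesgue_on S. P x"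
  obtains N where "negligible N" "\<And>x. x \<in> S - N \<Longrightarrow> P x"
proof -
  have "AE x in lebesgue. x \<in> S \<longrightarrow> P x"
    using assms by (subst (asm) AE_restrict_space_iff) auto
  then obtain N where "N \<in> null_sets lebesgue" "{x. \<not> (x \<in> S \<longrightarrow> P x)} \<subseteq> N"
    by (auto simp: eventually_ae_filter)
  then show ?thesis using that[of N] by (auto simp: negligible_iff_null_sets)
qed

text \<open>To the right of \<open>a\<close> the half-line filter is the full one. Hence
  \<open>dR 0\<close> and \<open>dR x0\<close> can both be read off from two-sided
  derivatives.\<close>

lemma dR_eq:
  assumes "a < x" "(f has_vector_derivative D) (at x)" shows "dR a f x = D"
proof -
  have "at x within {a..} = at x" using assms(1) by (intro at_within_interior) simp
  then show ?thesis using assms(2) by (simp add: dR_def vector_derivative_at)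
qed

text \<open>A priori \<open>dR 0 y\<close> equals the derivative of \<open>y\<close> only almost
  everywhere. Being absolutely continuous it is continuous, so its integral is continuously
  differentiable; that integral plus \<open>y 0\<close> is \<open>y\<close>, which is thus
  differentiable everywhere, including one-sidedly at 0.\<close>

lemma AC_primitive_has_derivative:
  assumes y: "AC_loc_from 0 y" and z: "AC_loc_from 0 (dR 0 y)" and x: "x \<in> {0..b}" and "0 < b"
  shows "(y has_vector_derivative dR 0 y x) (at x within {0..b})"
proof -
  have yb: "AC_on 0 b y" and zb: "AC_on 0 b (dR 0 y)" using y z \<open>0 < b\<close> by (auto simp: AC_loc_from_def)
  obtain g N where N: "negligible N" "\<And>x. x \<in> {0<..<b} - N \<Longrightarrow> (y has_vector_derivative g x) (at x)"
    and g: "\<And>s t. 0 \<le> s \<Longrightarrow> s \<le> t \<Longrightarrow> t \<le> b \<Longrightarrow> (g has_integral y t - y s) {s..t}"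
    using AC_on_FTC[OF \<open>0 < b\<close> yb] by metis
  have N': "negligible (N \<union> {0, b})" using N(1) by (simp add: negligible_Un)
  have int: "(dR 0 y has_integral y t - y 0) {0..t}" if t: "t \<in> {0..b}" for t
  proof (rule has_integral_spike[OF N' _ g[of 0 t]])
    fix s assume "s \<in> {0..t} - (N \<union> {0, b})"
    then have "s \<in> {0<..<b} - N" "0 < s" using t by auto
    then show "dR 0 y s = g s" using dR_eq[OF \<open>0 < s\<close>] N(2) by blast
  qed (use t in auto)
  have "((\<lambda>t. y 0 + integral {0..t} (dR 0 y)) has_vector_derivative dR 0 y x) (at x within {0..b})"
    using integral_has_vector_derivative[OF AC_on_continuous[OF zb] x]
    by (auto intro!: derivative_eq_intros)
  moreover have "y 0 + integral {0..t} (dR 0 y) = y t" if "t \<in> {0..b}" for t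
    using integral_unique[OF int[OF that]] by simp
  ultimately show ?thesis using x by (auto elim!: has_vector_derivative_transform[rotated -1])
qed

lemma AC_primitive_has_derivative_at:
  assumes "AC_loc_from 0 y" "AC_loc_from 0 (dR 0 y)" "0 < x"
  shows "(y has_vector_derivative dR 0 y x) (at x)"
proof -
  have "at x within {0..x + 1} = at x" using assms(3) by (intro at_within_interior) simp
  then show ?thesis using AC_primitive_has_derivative[OF assms(1,2), of x "x + 1"] assms(3) by simp
qed

section \<open>The energy inequality\<close>

text \<open>Pointwise algebra, with \<open>z\<close>, \<open>D\<close>, \<open>Dp\<close> in the
  roles of \<open>y'\<close>, \<open>W'\<close>, \<open>p'\<close>; \<open>eq\<close> is the
  differentiated identity \<open>W * p = cnj y * z\<close>. Solving for \<open>D\<close> and using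
  the inequality \<open>2 a b \<le> a^2 + b^2\<close> on both mixed terms gives the claim; the term
  with \<open>g\<close> also uses \<open>C \<le> cmod p\<close>.\<close>

lemma sqrt_equation_derivative_bound:
  fixes p y z g D Dp :: complex
  assumes "C > 0" "C \<le> Re p"
    and eq: "D * p + cnj y * z / p * Dp = cnj z * z + cnj y * (p\<^sup>2 * y - g)"
    and m: "m \<le> Re p - cmod (Dp / p) / 2"
  shows "m * ((cmod y)\<^sup>2 + (cmod (z / p))\<^sup>2) - ((cmod y)\<^sup>2 + (cmod g)\<^sup>2) / (2 * C) \<le> Re D"
proof -
  have p0: "p \<noteq> 0" using assms by auto
  define s where "s = z / p"
  define k where "k = Dp / p"
  have z: "z = s * p" using p0 by (simp add: s_def)
  have Dp: "Dp = k * p" using p0 by (simp add: k_def)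
  have "D * p + cnj y * s * (k * p) = cnj s * cnj p * (s * p) + cnj y * (p\<^sup>2 * y - g)"
    using eq p0 by (simp add: z Dp)
  moreover have "cnj y * g / p * p = cnj y * g" using p0 by simp
  ultimately have "D * p = (cnj s * s * cnj p + p * (cnj y * y) - cnj y * g / p - cnj y * s * k) * p"
    by (simp add: algebra_simps power2_eq_square)
  then have D: "D = cnj s * s * cnj p + p * (cnj y * y) - cnj y * g / p - cnj y * s * k"
    using p0 by simp
  have sq: "cnj w * w = of_real ((cmod w)\<^sup>2)" for w
    by (metis complex_norm_square mult.commute)
  have Re_D: "Re D = Re p * ((cmod s)\<^sup>2 + (cmod y)\<^sup>2) - Re (cnj y * g / p) - Re (cnj y * s * k)"
    unfolding D sq by (simp add: algebra_simps)
  have Cp: "C \<le> cmod p" using assms(2) complex_Re_le_cmod[of p] by simp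
  have "Re (cnj y * g / p) \<le> cmod y * cmod g / cmod p"
    using complex_Re_le_cmod[of "cnj y * g / p"] by (simp add: norm_mult norm_divide)
  also have "\<dots> \<le> cmod y * cmod g / C"
    using Cp \<open>C > 0\<close> by (intro divide_left_mono mult_nonneg_nonneg mult_pos_pos) auto
  also have "\<dots> \<le> ((cmod y)\<^sup>2 + (cmod g)\<^sup>2) / (2 * C)"
    using \<open>C > 0\<close> sum_squares_bound[of "cmod y" "cmod g"] by (simp add: field_simps)
  finally have 1: "Re (cnj y * g / p) \<le> ((cmod y)\<^sup>2 + (cmod g)\<^sup>2) / (2 * C)" .
  have "Re (cnj y * s * k) \<le> (cmod y * cmod s) * cmod k"
    using complex_Re_le_cmod[of "cnj y * s * k"] by (simp add: norm_mult)
  also have "\<dots> \<le> (((cmod s)\<^sup>2 + (cmod y)\<^sup>2) / 2) * cmod k"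
    using sum_squares_bound[of "cmod y" "cmod s"] by (intro mult_right_mono) auto
  finally have 2: "Re (cnj y * s * k) \<le> (cmod k / 2) * ((cmod s)\<^sup>2 + (cmod y)\<^sup>2)" by (simp add: algebra_simps)
  have "m * ((cmod y)\<^sup>2 + (cmod s)\<^sup>2) \<le> (Re p - cmod k / 2) * ((cmod s)\<^sup>2 + (cmod y)\<^sup>2)"
    using m by (subst add.commute) (intro mult_right_mono, auto simp: k_def)
  also have "\<dots> = Re p * ((cmod s)\<^sup>2 + (cmod y)\<^sup>2) - (cmod k / 2) * ((cmod s)\<^sup>2 + (cmod y)\<^sup>2)"
    by (simp add: left_diff_distrib)
  finally show ?thesis using 1 2 Re_D by (simp add: s_def)
qed

text \<open>Here \<open>z\<close> stands for \<open>y'\<close>, \<open>g\<close> for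
  \<open>l(y)\<close>, and \<open>N0\<close> is a null set outside of which the inequality of
  condition A holds. Nothing is assumed about \<open>z'\<close> or \<open>p'\<close> at points where
  these do not exist.\<close>

locale energy =
  fixes p q y z g :: "real \<Rightarrow> complex" and x0 C :: real and N0 :: "real set"
  assumes C: "C > 0" and AC_p: "\<And>b. AC_on x0 b p" and AC_y: "\<And>b. AC_on x0 b y" and AC_z: "\<And>b. AC_on x0 b z"
    and Re_p: "\<And>x. x \<ge> x0 \<Longrightarrow> C \<le> Re (p x)" and p_square: "\<And>x. (p x)\<^sup>2 = q x"
    and N0: "negligible N0"
    and rho_ge: "\<And>x D. x > x0 \<Longrightarrow> x \<notin> N0 \<Longrightarrow> (p has_vector_derivative D) (at x) \<Longrightarrow>
        C \<le> Re (p x) - cmod (D / p x) / 2"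
    and y_deriv: "\<And>x. x > x0 \<Longrightarrow> (y has_vector_derivative z x) (at x)"
    and z_deriv: "\<And>x D. x > x0 \<Longrightarrow> (z has_vector_derivative D) (at x) \<Longrightarrow> D = q x * y x - g x"
    and y_int: "(\<lambda>x. (cmod (y x))\<^sup>2) integrable_on {x0..}"
    and g_int: "(\<lambda>x. (cmod (g x))\<^sup>2) integrable_on {x0..}"
begin

definition "h x = ((cmod (y x))\<^sup>2 + (cmod (g x))\<^sup>2) / (2 * C)"
definition "S = integral {x0..} h"
text \<open>Complex-valued; the \<open>W\<close> of the overview is its real part. In this form it
  can be differentiated by the product rule.\<close>

definition "W x = cnj (y x) * z x / p x"
definition "E x = (cmod (y x))\<^sup>2 + (cmod (z x / p x))\<^sup>2"

lemma p_nonzero: "x \<ge> x0 \<Longrightarrow> p x \<noteq> 0"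
  using Re_p[of x] C by auto

lemma h_nonneg: "0 \<le> h x" using C by (simp add: h_def)

lemma h_integrable: "h integrable_on {x0..}"
  unfolding h_def[abs_def] using integrable_on_divide[OF integrable_add[OF y_int g_int]] by simp

lemma integrable_sub:
  fixes f :: "real \<Rightarrow> real"
  shows "f integrable_on {x0..} \<Longrightarrow> x0 \<le> a \<Longrightarrow> f integrable_on {a..b}"
  by (erule integrable_on_subinterval) auto

lemma integral_sub_le:
  fixes f :: "real \<Rightarrow> real"
  assumes "f integrable_on {x0..}" "x0 \<le> a" "\<And>x. 0 \<le> f x"
  shows "integral {a..b} f \<le> integral {x0..} f"
  using assms integrable_sub[OF assms(1,2)] by (intro integral_subset_le) auto

lemma AC_W: "AC_on x0 b W"
proof -
  have "AC_on x0 b (\<lambda>x. inverse (p x))"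
    by (rule AC_on_inverse[OF AC_p C]) (metis Re_p complex_Re_le_cmod order_trans atLeastAtMost_iff)
  from AC_on_mult[OF AC_on_mult[OF AC_on_cnj[OF AC_y] AC_z] this] show ?thesis
    by (simp add: W_def[abs_def] divide_inverse)
qed

lemma AC_W_sub: "x0 \<le> a \<Longrightarrow> AC_on a b W" using AC_on_subinterval[OF AC_W] by blast

lemma E_integrable: "x0 \<le> a \<Longrightarrow> E integrable_on {a..b}"
proof -
  assume a: "x0 \<le> a"
  have *: "continuous_on {a..b} f" if "AC_on x0 b f" for f
    by (rule continuous_on_subset[OF AC_on_continuous[OF that]]) (use a in auto)
  show ?thesis unfolding E_def[abs_def]
    by (intro integrable_continuous_real continuous_intros *[OF AC_y] *[OF AC_z] *[OF AC_p])
       (use a p_nonzero in auto)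
qed

text \<open>The product \<open>W * p = cnj y * z\<close> is differentiated in two ways and the
  results are equated, which avoids the quotient rule.\<close>

lemma W_derivative_bound:
  assumes x: "x > x0" and Dp: "(p has_vector_derivative Dp) (at x)"
    and Dz: "(z has_vector_derivative Dz) (at x)" and DW: "(W has_vector_derivative D) (at x)"
    and m: "m \<le> Re (p x) - cmod (Dp / p x) / 2"
  shows "m * E x - h x \<le> Re D"
proof -
  have 1: "((\<lambda>t. W t * p t) has_vector_derivative (W x * Dp + D * p x)) (at x)"
    by (rule has_vector_derivative_mult[OF DW Dp])
  have 2: "((\<lambda>t. cnj (y t) * z t) has_vector_derivative (cnj (y x) * Dz + cnj (z x) * z x)) (at x)"
    by (rule has_vector_derivative_mult[OF has_vector_derivative_cnj[OF y_deriv[OF x]] Dz])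
  have "((\<lambda>t. W t * p t) has_vector_derivative (cnj (y x) * Dz + cnj (z x) * z x)) (at x)"
    by (rule has_vector_derivative_transform_within_open[OF 2, of "{x0<..}"])
       (use x p_nonzero in \<open>auto simp: W_def\<close>)
  from vector_derivative_unique_at[OF 1 this]
  have "D * p x + cnj (y x) * z x / p x * Dp = cnj (z x) * z x + cnj (y x) * ((p x)\<^sup>2 * y x - g x)"
    using z_deriv[OF x Dz] by (simp add: W_def p_square algebra_simps)
  from sqrt_equation_derivative_bound[OF C Re_p this m] x
  show ?thesis by (simp add: E_def h_def)
qed

text \<open>Shared by \<open>W\<close> itself and by \<open>-1 / Re W\<close>. The hypothesis
  \<open>D\<close> receives the energy inequality at points where \<open>p\<close>, \<open>z\<close>
  and \<open>W\<close> all have derivatives, with \<open>m\<close> left free: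
  \<open>W_growth\<close> uses a general lower bound of \<open>rho\<close>, \<open>Re_W_le\<close>
  uses \<open>C\<close>.\<close>

lemma growth:
  assumes ab: "x0 \<le> a" "a \<le> b" and f: "AC_on a b f" "\<phi> integrable_on {a..b}" "negligible N"
    and D: "\<And>x Dp D Df. x \<in> {a<..<b} - N \<Longrightarrow> (p has_vector_derivative Dp) (at x) \<Longrightarrow>
        (W has_vector_derivative D) (at x) \<Longrightarrow> (f has_vector_derivative Df) (at x) \<Longrightarrow>
        (\<And>m. m \<le> Re (p x) - cmod (Dp / p x) / 2 \<Longrightarrow> m * E x - h x \<le> Re D) \<Longrightarrow> \<phi> x \<le> Re Df"
  shows "integral {a..b} \<phi> \<le> Re (f b) - Re (f a)"
proof (cases "a = b")
  case False
  with ab have "a < b" by simp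
  have ex: "\<exists>N. negligible N \<and> (\<forall>x\<in>{a<..<b} - N. \<exists>D. (f has_vector_derivative D) (at x))"
    if "\<And>b. AC_on x0 b f" for f
    using AC_on_FTC[OF \<open>a < b\<close> AC_on_subinterval[OF that[of b] ab(1) order_refl]] by metis
  obtain N1 where N1: "negligible N1" "\<forall>x\<in>{a<..<b} - N1. \<exists>D. (p has_vector_derivative D) (at x)"
    using ex[OF AC_p] by blast
  obtain N2 where N2: "negligible N2" "\<forall>x\<in>{a<..<b} - N2. \<exists>D. (z has_vector_derivative D) (at x)"
    using ex[OF AC_z] by blast
  obtain N3 where N3: "negligible N3" "\<forall>x\<in>{a<..<b} - N3. \<exists>D. (W has_vector_derivative D) (at x)"
    using ex[OF AC_W] by blast
  show ?thesis
  proof (rule AC_on_growth[OF ab(2) f(1,2), of "N \<union> N1 \<union> N2 \<union> N3"])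
    show "negligible (N \<union> N1 \<union> N2 \<union> N3)" using f(3) N1 N2 N3 by (simp add: negligible_Un)
    fix x Df assume x: "x \<in> {a<..<b} - (N \<union> N1 \<union> N2 \<union> N3)" and Df: "(f has_vector_derivative Df) (at x)"
    then obtain Dp Dz D where d: "(p has_vector_derivative Dp) (at x)" "(z has_vector_derivative Dz) (at x)"
      "(W has_vector_derivative D) (at x)"
      using N1 N2 N3 by (metis DiffD1 DiffD2 DiffI UnCI)
    show "\<phi> x \<le> Re Df"
      by (rule D[OF _ d(1,3) Df W_derivative_bound[OF _ d]]) (use x ab in auto)
  qed
qed simp

lemma W_growth:
  assumes "x0 \<le> a" "a \<le> b" "negligible N"
    and m: "\<And>x D. x \<in> {a<..<b} - N \<Longrightarrow> (p has_vector_derivative D) (at x) \<Longrightarrow>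
        m \<le> Re (p x) - cmod (D / p x) / 2"
  shows "m * integral {a..b} E \<le> Re (W b) - Re (W a) + S"
proof -
  have i: "E integrable_on {a..b}" "h integrable_on {a..b}"
    using E_integrable integrable_sub[OF h_integrable] assms by auto
  have "integral {a..b} (\<lambda>x. m * E x - h x) \<le> Re (W b) - Re (W a)"
  proof (rule growth[OF assms(1,2) AC_W_sub[OF assms(1)] _ assms(3)])
    show "(\<lambda>x. m * E x - h x) integrable_on {a..b}"
      using i by (intro integrable_diff integrable_on_mult_right)
  qed (use m vector_derivative_unique_at in \<open>metis\<close>)
  moreover have "integral {a..b} (\<lambda>x. m * E x - h x) = m * integral {a..b} E - integral {a..b} h"
    using i by (subst integral_diff) (auto intro: integrable_on_mult_right)
  moreover have "integral {a..b} h \<le> S" unfolding S_def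
    by (rule integral_sub_le[OF h_integrable assms(1) h_nonneg])
  ultimately show ?thesis by simp
qed

lemma E_nonneg: "0 \<le> E x" by (simp add: E_def)

lemma W_growth_C:
  assumes "x0 \<le> a" "a \<le> b" shows "C * integral {a..b} E \<le> Re (W b) - Re (W a) + S"
  by (rule W_growth[OF assms N0]) (use rho_ge assms in auto)

text \<open>Only the term \<open>h\<close> can make \<open>Re W\<close> decrease, and its integral
  over any interval is at most \<open>S\<close>.\<close>

lemma W_decrease_le:
  assumes "x0 \<le> a" "a \<le> b" shows "Re (W a) - S \<le> Re (W b)"
proof -
  have "0 \<le> C * integral {a..b} E"
    using C E_nonneg E_integrable[OF assms(1)] by (intro mult_nonneg_nonneg integral_nonneg) auto
  then show ?thesis using W_growth_C[OF assms] by simp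
qed

lemma Re_W_sq_le: "(Re (W x))\<^sup>2 \<le> (cmod (y x))\<^sup>2 * (cmod (z x / p x))\<^sup>2"
proof -
  have "\<bar>Re (W x)\<bar> \<le> cmod (y x) * cmod (z x / p x)"
    using abs_Re_le_cmod[of "W x"] by (simp add: W_def norm_mult norm_divide)
  then show ?thesis by (metis abs_le_square_iff abs_mult abs_norm_cancel power_mult_distrib)
qed

text \<open>If \<^term>\<open>Re (W x)\<close> ever exceeded \<^term>\<open>S\<close>, then \<open>w = Re W\<close> would stay above some \<open>\<eta> > 0\<close>, and
  \<open>(-1/w)' = w'/w\<^sup>2 \<ge> C / |y|\<^sup>2 - h/\<eta>\<^sup>2 \<ge> C (2 - |y|\<^sup>2) - h/\<eta>\<^sup>2\<close>, whose integral diverges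
  while \<open>-1/w\<close> is bounded.\<close>

lemma Re_W_le:
  assumes x1: "x0 \<le> x1" shows "Re (W x1) \<le> S"
proof (rule ccontr)
  assume "\<not> Re (W x1) \<le> S"
  \<comment> \<open>The excess over \<open>S\<close> is exactly what survives the largest possible
    later decrease.\<close>
  define \<eta> where "\<eta> = Re (W x1) - S"
  have \<eta>: "\<eta> > 0" using \<open>\<not> Re (W x1) \<le> S\<close> by (simp add: \<eta>_def)
  have w: "\<eta> \<le> Re (W x)" if "x1 \<le> x" for x using W_decrease_le[OF x1 that] by (simp add: \<eta>_def)
  define f where "f x = - inverse (complex_of_real (Re (W x)))" for x
  define \<phi> where "\<phi> x = C * (2 - (cmod (y x))\<^sup>2) - h x / \<eta>\<^sup>2" for x
  have bound: "2 * C * (b - x1) - C * integral {x0..} (\<lambda>x. (cmod (y x))\<^sup>2) - S / \<eta>\<^sup>2 \<le> inverse (Re (W x1))"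
    if b: "x1 \<le> b" for b
  proof -
    have yi: "(\<lambda>x. (cmod (y x))\<^sup>2) integrable_on {x1..b}" by (rule integrable_sub[OF y_int x1])
    have hi: "h integrable_on {x1..b}" by (rule integrable_sub[OF h_integrable x1])
    have "AC_on x1 b (\<lambda>x. inverse (complex_of_real (Re (W x))))"
      by (rule AC_on_inverse[OF AC_on_of_real_Re[OF AC_W_sub[OF x1]] \<eta>]) (use w \<eta> in force)
    then have fAC: "AC_on x1 b f"
      by (rule AC_on_dominated[where K = 1]) (auto simp: f_def norm_minus_commute)
    have \<phi>i: "\<phi> integrable_on {x1..b}"
      unfolding \<phi>_def using yi hi
      by (intro integrable_diff integrable_on_mult_right integrable_on_divide integrable_const_ivl)
    have "integral {x1..b} \<phi> \<le> Re (f b) - Re (f x1)"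
    proof (rule growth[OF x1 b fAC \<phi>i N0])
      fix x Dp D Df
      assume x: "x \<in> {x1<..<b} - N0" and Dp: "(p has_vector_derivative Dp) (at x)"
        and DW: "(W has_vector_derivative D) (at x)" and Df: "(f has_vector_derivative Df) (at x)"
        and m: "\<And>m. m \<le> Re (p x) - cmod (Dp / p x) / 2 \<Longrightarrow> m * E x - h x \<le> Re D"
      have wx: "\<eta> \<le> Re (W x)" using w x by auto
      have DRe: "((\<lambda>t. complex_of_real (Re (W t))) has_vector_derivative of_real (Re D)) (at x)"
        using bounded_linear.has_vector_derivative[OF bounded_linear_Re DW]
        by (intro has_vector_derivative_of_real) (simp add: has_real_derivative_iff_has_vector_derivative)
      \<comment> \<open>Near \<open>x\<close> the product of \<open>f\<close> and
        \<open>Re W\<close> is constantly -1, so the product rule and uniqueness of derivatives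
        identify \<open>Df\<close>.\<close>
      have "((\<lambda>t. f t * of_real (Re (W t))) has_vector_derivative (f x * of_real (Re D) + Df * of_real (Re (W x)))) (at x)"
        by (rule has_vector_derivative_mult[OF Df DRe])
      moreover have "((\<lambda>t. f t * of_real (Re (W t))) has_vector_derivative 0) (at x)"
      proof (rule has_vector_derivative_transform_within_open[of "\<lambda>_. -1" _ _ "{x1<..}"])
        fix t assume "t \<in> {x1<..}"
        then have "Re (W t) \<noteq> 0" using w[of t] \<eta> by auto
        then show "- 1 = f t * of_real (Re (W t))" by (simp add: f_def)
      qed (use x in auto)
      ultimately have "f x * of_real (Re D) + Df * of_real (Re (W x)) = 0"
        by (rule vector_derivative_unique_at)
      then have "Df = of_real (Re D / (Re (W x))\<^sup>2)"
        using wx \<eta> by (simp add: f_def field_simps power2_eq_square)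
      then have ReDf: "Re Df = Re D / (Re (W x))\<^sup>2" by simp
      have "C * E x - h x \<le> Re D" by (rule m) (use rho_ge[OF _ _ Dp] x x1 in auto)
      then have "(C * E x - h x) / (Re (W x))\<^sup>2 \<le> Re Df"
        unfolding ReDf by (rule divide_right_mono) simp
      moreover have "h x / (Re (W x))\<^sup>2 \<le> h x / \<eta>\<^sup>2"
        using wx \<eta> h_nonneg by (intro divide_left_mono power_mono) auto
      moreover have "2 - (cmod (y x))\<^sup>2 \<le> E x / (Re (W x))\<^sup>2"
      proof -
        \<comment> \<open>From \<open>(t - 1)^2 \<ge> 0\<close> comes
          \<open>(2 - t) * t \<le> 1\<close>. The resulting bound is linear in \<open>t\<close>, so
          it needs no division by \<open>y\<close> and its integral is controlled by the norm of
          \<open>y\<close>.\<close>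
        define t s where "t = (cmod (y x))\<^sup>2" and "s = (cmod (z x / p x))\<^sup>2"
        have ts: "0 \<le> t" "0 \<le> s" "(Re (W x))\<^sup>2 \<le> t * s" using Re_W_sq_le by (auto simp: t_def s_def)
        have "(2 - t) * (Re (W x))\<^sup>2 \<le> s"
        proof (cases "t \<le> 2")
          case True
          have "(2 - t) * (Re (W x))\<^sup>2 \<le> (2 - t) * (t * s)" using True ts by (intro mult_left_mono) auto
          also have "\<dots> = s - (t - 1)\<^sup>2 * s" by (simp add: algebra_simps power2_eq_square)
          also have "\<dots> \<le> s" using ts by simp
          finally show ?thesis .
        next
          case False
          then have "(2 - t) * (Re (W x))\<^sup>2 \<le> 0" by (intro mult_nonpos_nonneg) auto
          then show ?thesis using ts by simp
        qed
        also have "s \<le> E x" by (simp add: E_def s_def)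
        finally show ?thesis using wx \<eta> by (simp add: t_def pos_le_divide_eq)
      qed
      then have "C * (2 - (cmod (y x))\<^sup>2) \<le> C * (E x / (Re (W x))\<^sup>2)" using C by (intro mult_left_mono) auto
      ultimately show "\<phi> x \<le> Re Df" by (simp add: \<phi>_def diff_divide_distrib)
    qed
    also have "\<dots> \<le> inverse (Re (W x1))"
      using w[OF b] \<eta> by (simp add: f_def flip: of_real_inverse)
    finally have "integral {x1..b} \<phi> \<le> inverse (Re (W x1))" .
    moreover have "integral {x1..b} \<phi> = 2 * C * (b - x1) - C * integral {x1..b} (\<lambda>x. (cmod (y x))\<^sup>2) - integral {x1..b} h / \<eta>\<^sup>2"
    proof -
      have "((\<lambda>x. C * (2 - (cmod (y x))\<^sup>2) - h x / \<eta>\<^sup>2) has_integral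
          C * (2 * (b - x1) - integral {x1..b} (\<lambda>x. (cmod (y x))\<^sup>2)) - integral {x1..b} h / \<eta>\<^sup>2) {x1..b}"
        using has_integral_const_real[of "2 :: real" x1 b] b
        by (intro has_integral_diff has_integral_mult_right has_integral_divide integrable_integral yi hi)
           (auto simp: mult.commute)
      then show ?thesis unfolding \<phi>_def[abs_def] by (simp add: integral_unique algebra_simps)
    qed
    moreover have "C * integral {x1..b} (\<lambda>x. (cmod (y x))\<^sup>2) \<le> C * integral {x0..} (\<lambda>x. (cmod (y x))\<^sup>2)"
      using C integral_sub_le[OF y_int x1] by (intro mult_left_mono) auto
    moreover have "integral {x1..b} h / \<eta>\<^sup>2 \<le> S / \<eta>\<^sup>2"
      unfolding S_def using integral_sub_le[OF h_integrable x1 h_nonneg] by (intro divide_right_mono) auto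
    ultimately show ?thesis by simp
  qed
  define T where "T = C * integral {x0..} (\<lambda>x. (cmod (y x))\<^sup>2) + S / \<eta>\<^sup>2 + inverse (Re (W x1))"
  \<comment> \<open>Chosen so that \<open>2 * C * (b - x1) = \<bar>T\<bar> + 1\<close>, which
    exceeds \<open>T\<close>.\<close>
  define b where "b = x1 + (\<bar>T\<bar> + 1) / (2 * C)"
  have "x1 \<le> b" using C by (simp add: b_def)
  from bound[OF this] have "2 * C * (b - x1) \<le> T" by (simp add: T_def)
  moreover have "2 * C * (b - x1) = \<bar>T\<bar> + 1" using C by (simp add: b_def)
  ultimately show False by simp
qed

text \<open>The three copies of \<open>S\<close> come from the integral of \<open>h\<close>, from
  the upper bound of \<open>Re W\<close> at \<open>b\<close>, and from its possible decrease between
  \<open>x0\<close> and \<open>X\<close>.\<close>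

lemma tail_bound:
  assumes X: "x0 \<le> X" "X \<le> b" "negligible N"
    and m: "\<And>x D. x \<in> {X<..} - N \<Longrightarrow> (p has_vector_derivative D) (at x) \<Longrightarrow>
        m \<le> Re (p x) - cmod (D / p x) / 2" and "0 \<le> m"
  shows "m * integral {X..b} (\<lambda>x. (cmod (y x))\<^sup>2) \<le> 3 * S - Re (W x0)"
proof -
  have "m * integral {X..b} (\<lambda>x. (cmod (y x))\<^sup>2) \<le> m * integral {X..b} E"
    using \<open>0 \<le> m\<close> integrable_sub[OF y_int X(1)] E_integrable[OF X(1)]
    by (intro mult_left_mono integral_le) (auto simp: E_def)
  also have "\<dots> \<le> Re (W b) - Re (W X) + S"
    by (rule W_growth[OF X]) (use m in auto)
  also have "\<dots> \<le> 3 * S - Re (W x0)"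
    using Re_W_le[of b] W_decrease_le[OF order_refl X(1)] X by simp
  finally show ?thesis .
qed

end

section \<open>Local bounds and uniform decay\<close>

text \<open>In each outer third of the interval the mean of \<open>|y|^2\<close> is at most
  \<open>3 * B / l\<close>, so some point has \<open>|y| \<le> A\<close>. Two such points lie at
  least \<open>l / 3\<close> apart, so the mean slope between them is at most
  \<open>6 * A / l\<close>. Since \<open>z\<close> oscillates by at most
  \<open>e = Q * M + G\<close>, it is bounded by \<open>6 * A / l + e\<close>. Integrating from
  \<open>t1\<close>, the maximum \<open>M\<close> of \<open>|y|\<close> satisfies
  \<open>M \<le> 7 * A + l * Q * M + l * G\<close>, and \<open>l * Q \<le> 1 / 2\<close> absorbs the
  middle term.\<close>

lemma interval_bound:
  fixes q y z g :: "real \<Rightarrow> complex"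
  assumes l: "0 < l"
    and yd: "\<And>x. x \<in> {t..t+l} \<Longrightarrow> (y has_vector_derivative z x) (at x within {t..t+l})"
    and AC_z: "AC_on t (t + l) z"
    and zd: "\<And>x D. x \<in> {t<..<t+l} \<Longrightarrow> (z has_vector_derivative D) (at x) \<Longrightarrow> D = q x * y x - g x"
    and qi: "(\<lambda>x. cmod (q x)) integrable_on {t..t+l}" "integral {t..t+l} (\<lambda>x. cmod (q x)) \<le> Q"
    and lQ: "l * Q \<le> 1 / 2"
    and yi: "(\<lambda>x. (cmod (y x))\<^sup>2) integrable_on {t..t+l}" "integral {t..t+l} (\<lambda>x. (cmod (y x))\<^sup>2) \<le> B"
    and gi: "(\<lambda>x. cmod (g x)) integrable_on {t..t+l}" "integral {t..t+l} (\<lambda>x. cmod (g x)) \<le> G"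
    and x: "x \<in> {t..t+l}"
    and A: "A = sqrt (3 * B / l)" and M': "M' = 14 * A + 2 * l * G"
  shows "cmod (y x) \<le> M'" "cmod (z x) \<le> 6 * A / l + Q * M' + G"
proof -
  let ?I = "{t..t+l}"
  have ycont: "continuous_on ?I y"
    by (rule continuous_on_vector_derivative) (use yd in auto)
  then have ncont: "continuous_on ?I (\<lambda>x. cmod (y x))" by (rule continuous_on_norm)
  obtain xm where xm: "xm \<in> ?I" "\<And>x. x \<in> ?I \<Longrightarrow> cmod (y x) \<le> cmod (y xm)"
    using continuous_attains_sup[OF compact_Icc _ ncont] l by fastforce
  define M where "M = cmod (y xm)"
  have Q0: "0 \<le> Q" using qi(2) integral_nonneg[OF qi(1)] by (rule order_trans[rotated]) simp
  have G0: "0 \<le> G" using gi(2) integral_nonneg[OF gi(1)] by (rule order_trans[rotated]) simp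
  have B0: "0 \<le> B" using yi(2) integral_nonneg[OF yi(1)] by (rule order_trans[rotated]) simp
  define e where "e = Q * M + G"
  have e0: "0 \<le> e" using Q0 G0 by (simp add: e_def M_def)
  have osc: "cmod (z w - z v) \<le> e" if vw: "v \<in> ?I" "w \<in> ?I" "v \<le> w" for v w
  proof -
    define \<phi> where "\<phi> x = M * cmod (q x) + cmod (g x)" for x
    have \<phi>I: "\<phi> integrable_on ?I" unfolding \<phi>_def
      by (intro integrable_add integrable_on_mult_right qi gi)
    have \<phi>i: "\<phi> integrable_on {v..w}"
      by (rule integrable_on_subinterval[OF \<phi>I]) (use vw in auto)
    have "cmod (z w - z v) \<le> integral {v..w} \<phi>"
    proof (rule AC_on_increment_le[OF vw(3) _ \<phi>i negligible_empty])
      show "AC_on v w z" using AC_on_subinterval[OF AC_z] vw by auto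
      fix x D assume "x \<in> {v<..<w} - {}" and D: "(z has_vector_derivative D) (at x)"
      then have x: "x \<in> {t<..<t+l}" using vw by auto
      have "cmod D \<le> cmod (q x * y x) + cmod (g x)" unfolding zd[OF x D] by (rule norm_triangle_ineq4)
      also have "\<dots> \<le> \<phi> x" using xm(2)[of x] x by (auto simp: \<phi>_def M_def norm_mult mult.commute intro: mult_left_mono)
      finally show "cmod D \<le> \<phi> x" .
    qed
    also have "\<dots> \<le> integral ?I \<phi>"
      by (rule integral_subset_le[OF _ \<phi>i \<phi>I]) (use vw in \<open>auto simp: \<phi>_def M_def\<close>)
    also have "\<dots> = M * integral ?I (\<lambda>x. cmod (q x)) + integral ?I (\<lambda>x. cmod (g x))"
      unfolding \<phi>_def using qi(1) gi(1) by (subst integral_add) (auto intro: integrable_on_mult_right)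
    also have "\<dots> \<le> e"
      unfolding e_def by (subst mult.commute, intro add_mono mult_right_mono qi gi) (simp add: M_def)
    finally show ?thesis .
  qed
  have osc': "cmod (z w - z v) \<le> e" if "v \<in> ?I" "w \<in> ?I" for v w
    using osc[of v w] osc[of w v] that by (cases "v \<le> w") (auto simp: norm_minus_commute)
  have small: "\<exists>s\<in>{u..u + l / 3}. cmod (y s) \<le> A" if u: "t \<le> u" "u + l / 3 \<le> t + l" for u
  proof -
    have sub: "{u..u + l / 3} \<subseteq> ?I" using u by auto
    obtain s where s: "s \<in> {u..u + l / 3}" "\<And>x. x \<in> {u..u + l / 3} \<Longrightarrow> cmod (y s) \<le> cmod (y x)"
      using continuous_attains_inf[OF compact_Icc _ continuous_on_subset[OF ncont sub]] l by fastforce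
    have i: "(\<lambda>x. (cmod (y x))\<^sup>2) integrable_on {u..u + l / 3}"
      by (rule integrable_on_subinterval[OF yi(1) sub])
    have "l / 3 * (cmod (y s))\<^sup>2 = integral {u..u + l / 3} (\<lambda>x. (cmod (y s))\<^sup>2)"
      using l by simp
    also have "\<dots> \<le> integral {u..u + l / 3} (\<lambda>x. (cmod (y x))\<^sup>2)"
      using s i by (intro integral_le) auto
    also have "\<dots> \<le> integral ?I (\<lambda>x. (cmod (y x))\<^sup>2)"
      by (rule integral_subset_le[OF sub i yi(1)]) simp
    also have "\<dots> \<le> B" by (rule yi(2))
    finally have "(cmod (y s))\<^sup>2 \<le> 3 * B / l" using l by (simp add: field_simps)
    then have "cmod (y s) \<le> A" unfolding A by (rule real_le_rsqrt)
    with s(1) show ?thesis by blast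
  qed
  obtain t1 where t1: "t1 \<in> {t..t + l / 3}" "cmod (y t1) \<le> A" using small[of t] l by auto
  obtain t2 where t2: "t2 \<in> {t + 2 * l / 3..t + 2 * l / 3 + l / 3}" "cmod (y t2) \<le> A"
    using small[of "t + 2 * l / 3"] l by auto
  have A0: "0 \<le> A" using t1(2) norm_ge_zero order_trans by blast
  have tI: "t1 \<in> ?I" "t2 \<in> ?I" "l / 3 \<le> t2 - t1" using t1 t2 l by auto
  have zbound: "cmod (z x) \<le> 6 * A / l + e" if x: "x \<in> ?I" for x
  proof -
    \<comment> \<open>The oscillation bound lets the mean slope between \<open>t1\<close> and
      \<open>t2\<close> stand for \<open>z\<close> at an arbitrary point \<open>x\<close>, up to
      \<open>e\<close>.\<close>
    have "cmod (y t2 - y t1 - (t2 - t1) *\<^sub>R z x) \<le> norm (t2 - t1) * e"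
      by (rule vector_differentiable_bound_linearization[OF yd _ osc' x])
         (use tI x in \<open>auto simp: closed_segment_eq_real_ivl\<close>)
    moreover have "cmod ((t2 - t1) *\<^sub>R z x) \<le> cmod (y t2 - y t1) + cmod (y t2 - y t1 - (t2 - t1) *\<^sub>R z x)"
      using norm_triangle_ineq4[of "y t2 - y t1" "y t2 - y t1 - (t2 - t1) *\<^sub>R z x"] by simp
    moreover have "cmod (y t2 - y t1) \<le> 2 * A" using t1(2) t2(2) norm_triangle_ineq4[of "y t2" "y t1"] by simp
    ultimately have "(t2 - t1) * cmod (z x) \<le> 2 * A + (t2 - t1) * e" using tI(3) l by simp
    then have "(t2 - t1) * (cmod (z x) - e) \<le> 2 * A" by (simp add: algebra_simps)
    show ?thesis
    proof (cases "cmod (z x) \<le> e")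
      case True then show ?thesis using A0 l by (simp add: add_increasing)
    next
      case False
      then have "l / 3 * (cmod (z x) - e) \<le> (t2 - t1) * (cmod (z x) - e)" using tI(3) by (intro mult_right_mono) auto
      with \<open>(t2 - t1) * (cmod (z x) - e) \<le> 2 * A\<close> have "l / 3 * (cmod (z x) - e) \<le> 2 * A" by linarith
      then show ?thesis using l by (simp add: field_simps)
    qed
  qed
  have "cmod (y xm - y t1) \<le> (6 * A / l + e) * norm (xm - t1)"
    by (rule differentiable_bound[where S = ?I and f' = "\<lambda>x h. h *\<^sub>R z x"])
       (use yd zbound xm tI in \<open>auto simp: has_vector_derivative_def onorm_scaleR_left onorm_id\<close>)
  also have "\<dots> \<le> (6 * A / l + e) * l"
    using xm tI l A0 e0 by (intro mult_left_mono) auto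
  also have "\<dots> = 6 * A + l * Q * M + l * G" using l by (simp add: e_def field_simps)
  also have "\<dots> \<le> 6 * A + M / 2 + l * G"
    using mult_right_mono[OF lQ, of M] by (simp add: M_def)
  finally have "M \<le> 7 * A + M / 2 + l * G"
    using t1(2) norm_triangle_ineq2[of "y xm" "y t1"] by (simp add: M_def)
  then have MM: "M \<le> M'" by (simp add: M')
  then show "cmod (y x) \<le> M'" using xm(2)[OF x] by (simp add: M_def)
  have "Q * M \<le> Q * M'" using MM Q0 by (rule mult_left_mono)
  then show "cmod (z x) \<le> 6 * A / l + Q * M' + G" using zbound[OF x] by (simp add: e_def)
qed

lemma L2_integrable_on:
  assumes "f \<in> L2"
  shows "(\<lambda>x. (cmod (f x))\<^sup>2) integrable_on {0..}"
    and "integral {0..} (\<lambda>x. (cmod (f x))\<^sup>2) = (L2norm f)\<^sup>2"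
proof -
  have i: "integrable (lebesgue_on {0..}) (\<lambda>x. (cmod (f x))\<^sup>2)" using assms by (simp add: L2_def)
  show "(\<lambda>x. (cmod (f x))\<^sup>2) integrable_on {0..}" by (rule integrable_on_lebesgue_on[OF i]) simp
  have "integral {0..} (\<lambda>x. (cmod (f x))\<^sup>2) = integral\<^sup>L (lebesgue_on {0..}) (\<lambda>x. (cmod (f x))\<^sup>2)"
    by (rule lebesgue_integral_eq_integral[OF i, symmetric]) simp
  then show "integral {0..} (\<lambda>x. (cmod (f x))\<^sup>2) = (L2norm f)\<^sup>2"
    by (simp add: L2norm_def integral_nonneg_AE)
qed

text \<open>The crude estimate \<open>|w| \<le> 1 + |w|^2\<close> gives both local integrability and
  the bound on the integral of the modulus.\<close>

lemma L2_integrable_on_Icc: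
  assumes "f \<in> L2" "0 \<le> a"
  shows "(\<lambda>x. cmod (f x)) integrable_on {a..b}"
    and "a \<le> b \<Longrightarrow> integral {a..b} (\<lambda>x. cmod (f x)) \<le> (b - a) + (L2norm f)\<^sup>2"
    and "(\<lambda>x. (cmod (f x))\<^sup>2) integrable_on {a..b}"
    and "integral {a..b} (\<lambda>x. (cmod (f x))\<^sup>2) \<le> (L2norm f)\<^sup>2"
proof -
  have sub: "{a..b} \<subseteq> {0..}" using assms(2) by auto
  show i2: "(\<lambda>x. (cmod (f x))\<^sup>2) integrable_on {a..b}"
    by (rule integrable_on_subinterval[OF L2_integrable_on(1)[OF assms(1)] sub])
  show i2': "integral {a..b} (\<lambda>x. (cmod (f x))\<^sup>2) \<le> (L2norm f)\<^sup>2"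
    unfolding L2_integrable_on(2)[OF assms(1), symmetric]
    by (rule integral_subset_le[OF sub i2 L2_integrable_on(1)[OF assms(1)]]) simp
  have le: "cmod w \<le> 1 + (cmod w)\<^sup>2" for w
    using sum_squares_bound[of 1 "cmod w"] norm_ge_zero[of w] unfolding power_one by linarith
  have ig: "(\<lambda>x. 1 + (cmod (f x))\<^sup>2) integrable_on {a..b}"
    by (intro integrable_add i2 integrable_const_ivl)
  have "f \<in> borel_measurable (lebesgue_on {0..})" using assms(1) by (simp add: L2_def)
  then have "f \<in> borel_measurable (lebesgue_on {a..b})" by (rule measurable_restrict_mono) (rule sub)
  then have m: "(\<lambda>x. cmod (f x)) \<in> borel_measurable (lebesgue_on {a..b})" by measurable
  show i1: "(\<lambda>x. cmod (f x)) integrable_on {a..b}"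
    by (rule measurable_bounded_by_integrable_imp_integrable_real[OF m ig]) (use le in auto)
  assume ab: "a \<le> b"
  have "integral {a..b} (\<lambda>x. cmod (f x)) \<le> integral {a..b} (\<lambda>x. 1 + (cmod (f x))\<^sup>2)"
    by (rule integral_le[OF i1 ig]) (use le in auto)
  also have "\<dots> = (b - a) + integral {a..b} (\<lambda>x. (cmod (f x))\<^sup>2)"
    using ab i2 by (subst integral_add) auto
  finally show "integral {a..b} (\<lambda>x. cmod (f x)) \<le> (b - a) + (L2norm f)\<^sup>2" using i2' by simp
qed

lemma AC_loc_from_AC_on:
  assumes "AC_loc_from a f" "a \<le> c" shows "AC_on c b f"
  by (rule AC_on_subinterval[of a "max a b"]) (use assms in \<open>auto simp: AC_loc_from_def\<close>)

text \<open>A set bounded in the graph norm of the maximal operator; \<open>B\<close> bounds squared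
  norms, the form in which they enter all estimates.\<close>

definition Dmax_ball :: "(real \<Rightarrow> complex) \<Rightarrow> real \<Rightarrow> (real \<Rightarrow> complex) set" where
  "Dmax_ball q B = {y \<in> Dmax q. (L2norm y)\<^sup>2 \<le> B \<and> (L2norm (lexpr q y))\<^sup>2 \<le> B}"

text \<open>\<open>interval_bound\<close> is applied on a window starting at the point in question.
  The window length depends only on \<open>q\<close> and \<open>b\<close>, so the bound is uniform
  over the ball.\<close>

lemma Dmax_ball_local_bound:
  assumes q: "L1_loc q" and "0 \<le> b" "0 \<le> B"
  obtains K where "\<And>y x. y \<in> Dmax_ball q B \<Longrightarrow> x \<in> {0..b} \<Longrightarrow> cmod (y x) \<le> K \<and> cmod (dR 0 y x) \<le> K"
proof -
  have qai: "q absolutely_integrable_on {0..b + 1}" using q \<open>0 \<le> b\<close> by (simp add: L1_loc_def)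
  then have qi: "(\<lambda>x. cmod (q x)) integrable_on {0..b + 1}" by (rule absolutely_integrable_on_def[THEN iffD1, THEN conjunct2])
  define Q where "Q = integral {0..b + 1} (\<lambda>x. cmod (q x))"
  have Q0: "0 \<le> Q" unfolding Q_def by (rule integral_nonneg[OF qi]) simp
  \<comment> \<open>This gives \<open>l * Q \<le> 1 / 2\<close> as well as \<open>l \<le> 1\<close>,
    so that windows starting in \<open>{0..b}\<close> stay inside \<open>{0..b + 1}\<close>.\<close>
  define l where "l = 1 / (2 * (Q + 1))"
  have l: "0 < l" "l \<le> 1" "l * Q \<le> 1 / 2" using Q0 by (auto simp: l_def field_simps)
  define G where "G = l + B"
  define A where "A = sqrt (3 * B / l)"
  define M where "M = 14 * A + 2 * l * G"
  show ?thesis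
  proof (rule that)
    fix y t assume y: "y \<in> Dmax_ball q B" and t: "t \<in> {0..b}"
    let ?I = "{t..t+l}"
    have sub: "?I \<subseteq> {0..b + 1}" using t l by auto
    have yL2: "y \<in> L2" and gL2: "lexpr q y \<in> L2" and AC: "AC_loc_from 0 y" "AC_loc_from 0 (dR 0 y)"
      and nB: "(L2norm y)\<^sup>2 \<le> B" "(L2norm (lexpr q y))\<^sup>2 \<le> B"
      using y by (auto simp: Dmax_ball_def Dmax_def)
    have yd: "(y has_vector_derivative dR 0 y x) (at x within ?I)" if "x \<in> ?I" for x
      using AC_primitive_has_derivative[OF AC, of x "b + 1"] that sub \<open>0 \<le> b\<close>
      by (intro has_vector_derivative_within_subset[OF _ sub]) auto
    have ACz: "AC_on t (t + l) (dR 0 y)"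
      by (rule AC_loc_from_AC_on[OF AC(2)]) (use t in simp)
    have zd: "D = q x * y x - lexpr q y x" if "x \<in> {t<..<t+l}" "(dR 0 y has_vector_derivative D) (at x)" for x D
      using dR_eq[OF _ that(2), of 0] that(1) t by (simp add: lexpr_def)
    have qi': "(\<lambda>x. cmod (q x)) integrable_on ?I" by (rule integrable_on_subinterval[OF qi sub])
    have qQ: "integral ?I (\<lambda>x. cmod (q x)) \<le> Q"
      unfolding Q_def by (rule integral_subset_le[OF sub qi' qi]) simp
    have "0 \<le> t" using t by simp
    note yI = L2_integrable_on_Icc[OF yL2 \<open>0 \<le> t\<close>] and gI = L2_integrable_on_Icc[OF gL2 \<open>0 \<le> t\<close>]
    have gG: "integral ?I (\<lambda>x. cmod (lexpr q y x)) \<le> G" using gI(2)[of "t + l"] nB l by (simp add: G_def)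
    have yB: "integral ?I (\<lambda>x. (cmod (y x))\<^sup>2) \<le> B" using yI(4)[of "t + l"] nB by simp
    have tI: "t \<in> ?I" using l by simp
    note b = interval_bound[OF l(1) yd ACz zd qi' qQ l(3) yI(3) yB gI(1) gG tI A_def M_def]
    show "cmod (y t) \<le> max M (6 * A / l + Q * M + G) \<and> cmod (dR 0 y t) \<le> max M (6 * A / l + Q * M + G)"
      using b by auto
  qed
qed

section \<open>Consequences of condition A\<close>

text \<open>Condition A gives the bound only almost everywhere. By continuity of \<open>Re p\<close>
  the set of violations beyond \<open>x0\<close> is open; being negligible it is empty, and
  \<open>x0\<close> itself follows by taking the closure.\<close>

lemma condA_Re_pfun:
  assumes "condA q x0"
  obtains C where "C > 0" "\<And>x. x \<ge> x0 \<Longrightarrow> C \<le> Re (pfun q x)"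
    "AE x in lebesgue_on {x0..}. Re (pfun q x) \<ge> C + cmod (dR x0 (pfun q) x / pfun q x) / 2"
proof -
  obtain C where C: "C > 0" "AE x in lebesgue_on {x0..}. Re (pfun q x) \<ge> C + cmod (dR x0 (pfun q) x / pfun q x) / 2"
    and pos: "\<And>x. x \<ge> x0 \<Longrightarrow> Re (pfun q x) > 0" and AC: "AC_loc_from x0 q"
    using assms by (auto simp: condA_def)
  have qc: "continuous_on {x0..} q"
    unfolding continuous_on_eq_continuous_within
  proof
    fix x assume "x \<in> {x0..}"
    then have "continuous (at x within {x0..x + 1}) q"
      using AC_on_continuous[of x0 "x + 1" q] AC by (auto simp: AC_loc_from_def continuous_on_eq_continuous_within)
    moreover have "at x within {x0..x + 1} = at x within {x0..}"
      by (rule at_within_nhd[of x "{..<x + 1}"]) auto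
    ultimately show "continuous (at x within {x0..}) q" by simp
  qed
  \<comment> \<open>The branch cut does no harm: on the nonpositive reals \<open>csqrt\<close> has
    real part 0, so they lie outside this set.\<close>
  have cs: "continuous_on {w. Re (csqrt w) > 0} csqrt"
  proof (intro continuous_at_imp_continuous_on ballI continuous_at_csqrt)
    fix w assume "w \<in> {w. Re (csqrt w) > 0}"
    then show "w \<notin> \<real>\<^sub>\<le>\<^sub>0" by (auto elim!: nonpos_Reals_cases simp: csqrt_of_real_nonpos simp del: csqrt.sel)
  qed
  have pc: "continuous_on {x0..} (\<lambda>x. Re (pfun q x))"
    unfolding pfun_def by (intro continuous_on_Re continuous_on_compose2[OF cs qc]) (use pos in \<open>auto simp: pfun_def\<close>)
  obtain N where N: "negligible N" "\<And>x. x \<in> {x0..} - N \<Longrightarrow>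
      Re (pfun q x) \<ge> C + cmod (dR x0 (pfun q) x / pfun q x) / 2"
    using AE_lebesgue_on_negligible[OF _ C(2)] by auto
  have int: "C \<le> Re (pfun q x)" if x: "x \<in> {x0<..}" for x
  proof (rule ccontr)
    assume "\<not> C \<le> Re (pfun q x)"
    define U where "U = {x \<in> {x0<..}. Re (pfun q x) < C}"
    have "open ({x0<..} \<inter> (\<lambda>x. Re (pfun q x)) -` {..<C})"
      by (rule continuous_open_preimage[OF continuous_on_subset[OF pc]]) auto
    also have "{x0<..} \<inter> (\<lambda>x. Re (pfun q x)) -` {..<C} = U" by (auto simp: U_def)
    finally have "open U" .
    have "U \<subseteq> N"
    proof
      fix t assume t: "t \<in> U"
      show "t \<in> N"
      proof (rule ccontr)
        assume "t \<notin> N"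
        then have "C + cmod (dR x0 (pfun q) t / pfun q t) / 2 \<le> Re (pfun q t)" using N(2)[of t] t by (auto simp: U_def)
        moreover have "0 \<le> cmod (dR x0 (pfun q) t / pfun q t) / 2" by simp
        ultimately show False using t unfolding U_def by (simp only: mem_Collect_eq) linarith
      qed
    qed
    then have "negligible U" using N(1) negligible_subset by blast
    then have "U = {}" using \<open>open U\<close> open_not_negligible by blast
    then show False using x \<open>\<not> C \<le> Re (pfun q x)\<close> by (auto simp: U_def)
  qed
  have "C \<le> Re (pfun q x)" if "x \<ge> x0" for x
    by (rule continuous_ge_on_closure[of "{x0<..}" "\<lambda>x. Re (pfun q x)"]) (use that pc int in auto)
  with C that show ?thesis by blast
qed

text \<open>An increment of \<open>q\<close> is the increment of \<open>p\<close> times the sum of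
  the two values of \<open>p\<close>, and that sum has modulus at least
  \<open>2 * C\<close>.\<close>

lemma AC_on_pfun:
  assumes AC: "AC_loc_from x0 q" and C: "C > 0" "\<And>x. x \<ge> x0 \<Longrightarrow> C \<le> Re (pfun q x)"
  shows "AC_on x0 b (pfun q)"
proof (rule AC_on_dominated[OF AC_loc_from_AC_on[OF AC order_refl], of "1 / (2 * C)"])
  fix x y assume xy: "x0 \<le> x" "x \<le> y" "y \<le> b"
  have "2 * C \<le> cmod (pfun q y + pfun q x)"
    using C(2)[of x] C(2)[of y] complex_Re_le_cmod[of "pfun q y + pfun q x"] xy by simp
  then have "cmod (pfun q y - pfun q x) * (2 * C) \<le> cmod (pfun q y - pfun q x) * cmod (pfun q y + pfun q x)"
    by (intro mult_left_mono) auto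
  also have "\<dots> = cmod (q y - q x)"
  proof -
    have "(pfun q y - pfun q x) * (pfun q y + pfun q x) = (pfun q y)\<^sup>2 - (pfun q x)\<^sup>2"
      by (simp add: algebra_simps power2_eq_square)
    then show ?thesis by (simp add: pfun_def flip: norm_mult)
  qed
  finally show "cmod (pfun q y - pfun q x) \<le> 1 / (2 * C) * cmod (q y - q x)"
    using C(1) by (simp add: field_simps)
qed (use C in auto)

lemma integrable_on_tail:
  fixes f :: "real \<Rightarrow> real"
  assumes "f integrable_on {a..}" "a \<le> c" "\<And>x. 0 \<le> f x"
  shows "f integrable_on {c..}"
proof -
  have "set_integrable lebesgue {a..} f"
    using assms(1,3) by (intro nonnegative_absolutely_integrable_1) auto
  then have "set_integrable lebesgue {c..} f" by (rule set_integrable_subset) (use assms(2) in auto)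
  then show ?thesis by (rule set_lebesgue_integral_eq_integral(1))
qed

lemma integral_tail_le:
  fixes f :: "real \<Rightarrow> real"
  assumes "f integrable_on {X..}" "\<And>x. 0 \<le> f x" "\<And>b. X \<le> b \<Longrightarrow> integral {X..b} f \<le> c"
  shows "integral {X..} f \<le> c"
proof -
  have i: "set_integrable lebesgue {X..} f"
    using assms(1,2) by (intro nonnegative_absolutely_integrable_1) auto
  have "((\<lambda>b. set_lebesgue_integral lebesgue {X..b} f) \<longlongrightarrow> set_lebesgue_integral lebesgue {X..} f) at_top"
    by (rule tendsto_set_lebesgue_integral_at_top[OF _ i]) auto
  moreover have "\<forall>\<^sub>F b in at_top. set_lebesgue_integral lebesgue {X..b} f \<le> c"
    using eventually_ge_at_top[of X]
  proof eventually_elim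
    case (elim b)
    have "set_integrable lebesgue {X..b} f" by (rule set_integrable_subset[OF i]) auto
    then show ?case using assms(3)[OF elim] by (simp add: set_lebesgue_integral_eq_integral)
  qed
  ultimately have "set_lebesgue_integral lebesgue {X..} f \<le> c"
    by (rule tendsto_upperbound) simp
  then show ?thesis using i by (simp add: set_lebesgue_integral_eq_integral)
qed

text \<open>Over the ball \<open>S\<close> is at most \<open>B / C\<close>, and
  \<open>-Re (W x0)\<close> is at most \<open>K * K / C\<close> by the local bound at
  \<open>x0\<close>. So one \<open>X\<close>, chosen from \<open>B\<close> and \<open>e\<close>
  alone, serves every \<open>y\<close>.\<close>

lemma Dmax_ball_tail:
  assumes "x0 \<ge> 0" and q: "L1_loc q" and A: "condA q x0"
    and rho: "\<forall>M. \<exists>X\<ge>x0. AE x in lebesgue_on {X..}. rho q x0 x \<ge> M"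
    and "0 \<le> B" "0 < e"
  obtains X where "X \<ge> 0" "\<And>y. y \<in> Dmax_ball q B \<Longrightarrow> integral {X..} (\<lambda>x. (cmod (y x))\<^sup>2) \<le> e"
proof -
  obtain C where C: "C > 0" "\<And>x. x \<ge> x0 \<Longrightarrow> C \<le> Re (pfun q x)"
    "AE x in lebesgue_on {x0..}. Re (pfun q x) \<ge> C + cmod (dR x0 (pfun q) x / pfun q x) / 2"
    using condA_Re_pfun[OF A] by blast
  obtain N0 where N0: "negligible N0" "\<And>x. x \<in> {x0..} - N0 \<Longrightarrow>
      Re (pfun q x) \<ge> C + cmod (dR x0 (pfun q) x / pfun q x) / 2"
    using AE_lebesgue_on_negligible[OF _ C(3)] by auto
  have ACq: "AC_loc_from x0 q" using A by (simp add: condA_def)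
  obtain K where K: "\<And>y x. y \<in> Dmax_ball q B \<Longrightarrow> x \<in> {0..x0} \<Longrightarrow> cmod (y x) \<le> K \<and> cmod (dR 0 y x) \<le> K"
    using Dmax_ball_local_bound[OF q \<open>x0 \<ge> 0\<close> \<open>0 \<le> B\<close>] by blast
  define T where "T = 3 * (B / C) + K * K / C"
  \<comment> \<open>Then \<open>m * e = \<bar>T\<bar> + e\<close> dominates \<open>T\<close>, and
    the summand 1 keeps \<open>m\<close> positive even if \<open>T = 0\<close>.\<close>
  define m where "m = \<bar>T\<bar> / e + 1"
  have "m * e = \<bar>T\<bar> + e" using \<open>0 < e\<close> by (simp add: m_def field_simps)
  moreover have "0 < m" unfolding m_def using \<open>0 < e\<close> by (intro add_nonneg_pos) auto
  ultimately have m: "0 < m" "T \<le> m * e" using \<open>0 < e\<close> by auto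
  obtain X where X: "X \<ge> x0" "AE x in lebesgue_on {X..}. rho q x0 x \<ge> m" using rho by blast
  obtain N where N: "negligible N" "\<And>x. x \<in> {X..} - N \<Longrightarrow> rho q x0 x \<ge> m"
    using AE_lebesgue_on_negligible[OF _ X(2)] by auto
  show ?thesis
  proof (rule that[of X])
    show "0 \<le> X" using X \<open>x0 \<ge> 0\<close> by simp
    fix y assume y: "y \<in> Dmax_ball q B"
    have yL2: "y \<in> L2" and gL2: "lexpr q y \<in> L2" and AC: "AC_loc_from 0 y" "AC_loc_from 0 (dR 0 y)"
      and nB: "(L2norm y)\<^sup>2 \<le> B" "(L2norm (lexpr q y))\<^sup>2 \<le> B"
      using y by (auto simp: Dmax_ball_def Dmax_def)
    interpret energy "pfun q" q y "dR 0 y" "lexpr q y" x0 C N0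
    proof
      show "AC_on x0 b (pfun q)" for b by (rule AC_on_pfun[OF ACq C(1,2)])
      show "AC_on x0 b y" "AC_on x0 b (dR 0 y)" for b using AC_loc_from_AC_on AC \<open>x0 \<ge> 0\<close> by blast+
      show "(pfun q x)\<^sup>2 = q x" for x by (simp add: pfun_def)
      show "C \<le> Re (pfun q x) - cmod (D / pfun q x) / 2"
        if "x > x0" "x \<notin> N0" "(pfun q has_vector_derivative D) (at x)" for x D
        using N0(2)[of x] dR_eq[OF that(1,3)] that by simp
      show "(y has_vector_derivative dR 0 y x) (at x)" if "x > x0" for x
        by (rule AC_primitive_has_derivative_at[OF AC]) (use that \<open>x0 \<ge> 0\<close> in simp)
      show "D = q x * y x - lexpr q y x" if "x > x0" "(dR 0 y has_vector_derivative D) (at x)" for x D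
        using dR_eq[OF _ that(2), of 0] that(1) \<open>x0 \<ge> 0\<close> by (simp add: lexpr_def)
    qed (use C N0 integrable_on_tail[OF L2_integrable_on(1)] yL2 gL2 \<open>x0 \<ge> 0\<close> in auto)
    have le: "integral {c..} (\<lambda>x. (cmod (f x))\<^sup>2) \<le> B" if "f \<in> L2" "(L2norm f)\<^sup>2 \<le> B" "0 \<le> c" for f c
    proof -
      have "integral {c..} (\<lambda>x. (cmod (f x))\<^sup>2) \<le> integral {0..} (\<lambda>x. (cmod (f x))\<^sup>2)"
        by (rule integral_subset_le) (use that L2_integrable_on(1)[OF that(1)] integrable_on_tail[OF L2_integrable_on(1)[OF that(1)]] in auto)
      then show ?thesis using L2_integrable_on(2)[OF that(1)] that(2) by simp
    qed
    have SB: "S \<le> B / C"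
    proof -
      have "S = (integral {x0..} (\<lambda>x. (cmod (y x))\<^sup>2) + integral {x0..} (\<lambda>x. (cmod (lexpr q y x))\<^sup>2)) / (2 * C)"
        unfolding S_def h_def[abs_def] using y_int g_int by (simp add: integral_add)
      also have "\<dots> \<le> (B + B) / (2 * C)"
        using le[OF yL2 nB(1) \<open>x0 \<ge> 0\<close>] le[OF gL2 nB(2) \<open>x0 \<ge> 0\<close>] C(1) by (intro divide_right_mono add_mono) auto
      finally show ?thesis using C(1) by simp
    qed
    have WK: "- Re (W x0) \<le> K * K / C"
    proof -
      have k: "cmod (y x0) \<le> K" "cmod (dR 0 y x0) \<le> K" using K[OF y, of x0] \<open>x0 \<ge> 0\<close> by auto
      have Cp: "C \<le> cmod (pfun q x0)" using Re_p[of x0] complex_Re_le_cmod[of "pfun q x0"] by simp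
      have "- Re (W x0) \<le> cmod (W x0)" using abs_Re_le_cmod[of "W x0"] by simp
      also have "\<dots> = cmod (y x0) * cmod (dR 0 y x0) / cmod (pfun q x0)" by (simp add: W_def norm_mult norm_divide)
      also have "\<dots> \<le> K * K / C"
        using k Cp C(1) by (intro frac_le mult_mono) (auto intro: order_trans[OF norm_ge_zero])
      finally show ?thesis .
    qed
    show "integral {X..} (\<lambda>x. (cmod (y x))\<^sup>2) \<le> e"
    proof (rule integral_tail_le)
      show "(\<lambda>x. (cmod (y x))\<^sup>2) integrable_on {X..}"
        by (rule integrable_on_tail[OF L2_integrable_on(1)[OF yL2] \<open>0 \<le> X\<close>]) simp
      fix b assume "X \<le> b"
      have "m * integral {X..b} (\<lambda>x. (cmod (y x))\<^sup>2) \<le> 3 * S - Re (W x0)"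
      proof (rule tail_bound[OF X(1) \<open>X \<le> b\<close> N(1)])
        fix x D assume x: "x \<in> {X<..} - N" and D: "(pfun q has_vector_derivative D) (at x)"
        have "x0 < x" using x X by auto
        from N(2)[of x] x dR_eq[OF this D] show "m \<le> Re (pfun q x) - cmod (D / pfun q x) / 2"
          by (simp add: rho_def)
      qed (use m in simp)
      also have "\<dots> \<le> T" using SB WK by (simp add: T_def)
      also have "\<dots> \<le> m * e" by (rule m(2))
      finally show "integral {X..b} (\<lambda>x. (cmod (y x))\<^sup>2) \<le> e" using m(1) by simp
    qed simp
  qed
qed

section \<open>Compactness\<close>

lemma L2_square_nn_integral:
  assumes "f \<in> borel_measurable (lebesgue_on {0..})"
  shows "L2norm f = sqrt (enn2real (\<integral>\<^sup>+x. ennreal ((cmod (f x))\<^sup>2) \<partial>lebesgue_on {0..}))"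
proof -
  have "(\<lambda>x. (cmod (f x))\<^sup>2) \<in> borel_measurable (lebesgue_on {0..})" using assms by measurable
  then show ?thesis unfolding L2norm_def by (subst integral_eq_nn_integral) auto
qed

text \<open>An Arzela-Ascoli argument combined with tightness: a subsequence converges at the
  rationals, equicontinuity carries this to all points, dominated convergence handles
  \<open>{0..X}\<close>, and Fatou transfers the tail bound to the limit.\<close>

lemma L2_compact_criterion:
  fixes Y :: "nat \<Rightarrow> real \<Rightarrow> complex"
  assumes Y: "\<And>n. Y n \<in> L2"
    and bdd: "\<And>b. b \<ge> 0 \<Longrightarrow> \<exists>K. \<forall>n. \<forall>x\<in>{0..b}. cmod (Y n x) \<le> K"
    and lip: "\<And>b. b \<ge> 0 \<Longrightarrow> \<exists>K. \<forall>n. \<forall>x\<in>{0..b}. \<forall>w\<in>{0..b}. cmod (Y n x - Y n w) \<le> K * \<bar>x - w\<bar>"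
    and norm_le: "\<And>n. integral {0..} (\<lambda>x. (cmod (Y n x))\<^sup>2) \<le> B"
    and tail: "\<And>e. e > 0 \<Longrightarrow> \<exists>X\<ge>0. \<forall>n. integral {X..} (\<lambda>x. (cmod (Y n x))\<^sup>2) \<le> e"
  obtains r g where "strict_mono r" "g \<in> L2" "(\<lambda>n. L2norm (\<lambda>x. Y (r n) x - g x)) \<longlonglongrightarrow> 0"
proof -
  let ?M = "lebesgue_on {0 :: real..}"
  obtain K where K: "\<And>b n x. b \<ge> 0 \<Longrightarrow> x \<in> {0..b} \<Longrightarrow> cmod (Y n x) \<le> K b"
    using bdd by metis
  \<comment> \<open>The bounds on \<open>Y n x\<close> depend on \<open>x\<close>, whereas the
    subsequence principle wants one bound on the whole countable set; dividing by \<open>R x\<close>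
    normalises the values.\<close>
  define R where "R x = max 1 (K x)" for x
  have R: "R x \<ge> 1" "x \<ge> 0 \<Longrightarrow> cmod (Y n x) \<le> R x" for n x
    using K[of x x n] by (auto simp: R_def)
  define D where "D = \<rat> \<inter> {0 :: real..}"
  have "countable D" unfolding D_def using countable_rat by (rule countable_Int1)
  moreover have "norm (Y n x / of_real (R x)) \<le> 1" if "x \<in> D" for n x
    using R[of x] that by (auto simp: D_def norm_divide)
  ultimately obtain r where r: "strict_mono r" and rlim: "\<And>x. x \<in> D \<Longrightarrow> \<exists>l. (\<lambda>n. Y (r n) x / of_real (R x)) \<longlonglongrightarrow> l"
    using function_convergent_subsequence[of D "\<lambda>n x. Y n x / of_real (R x)" 1] by blast
  have convD: "Cauchy (\<lambda>n. Y (r n) x)" if x: "x \<in> D" for x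
  proof -
    obtain l where "(\<lambda>n. Y (r n) x / of_real (R x)) \<longlonglongrightarrow> l" using rlim[OF x] by blast
    then have "(\<lambda>n. of_real (R x) * (Y (r n) x / of_real (R x))) \<longlonglongrightarrow> of_real (R x) * l" by (rule tendsto_mult_left)
    then have "(\<lambda>n. Y (r n) x) \<longlonglongrightarrow> of_real (R x) * l" using R(1)[of x] by simp
    then show ?thesis by (rule LIMSEQ_imp_Cauchy)
  qed
  have conv: "convergent (\<lambda>n. Y (r n) x)" if x: "x \<ge> 0" for x
    unfolding Cauchy_convergent_iff[symmetric]
  proof (rule metric_CauchyI)
    fix e :: real assume "e > 0"
    obtain L where L: "\<forall>n. \<forall>v\<in>{0..x + 1}. \<forall>w\<in>{0..x + 1}. cmod (Y n v - Y n w) \<le> L * \<bar>v - w\<bar>"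
      using lip[of "x + 1"] x by auto
    define d where "d = min 1 (e / 3 / (\<bar>L\<bar> + 1))"
    have "d \<le> e / 3 / (\<bar>L\<bar> + 1)" by (simp add: d_def)
    then have "d * (\<bar>L\<bar> + 1) \<le> e / 3" by (subst (asm) pos_le_divide_eq) auto
    then have d: "d > 0" "d \<le> 1" "(\<bar>L\<bar> + 1) * d \<le> e / 3"
      using \<open>e > 0\<close> by (auto simp: d_def mult.commute)
    obtain w where w: "w \<in> \<rat>" "x < w" "w < x + d" using Rats_dense_in_real[of x "x + d"] d by auto
    then have "w \<in> D" using x by (simp add: D_def)
    from metric_CauchyD[OF convD[OF this], of "e / 3"] \<open>e > 0\<close>
    obtain N where N: "\<And>m n. m \<ge> N \<Longrightarrow> n \<ge> N \<Longrightarrow> cmod (Y (r m) w - Y (r n) w) < e / 3" by (auto simp: dist_norm)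
    have near: "cmod (Y n x - Y n w) \<le> e / 3" for n
    proof -
      have "cmod (Y n x - Y n w) \<le> L * \<bar>x - w\<bar>" by (rule L[rule_format]) (use x w d in auto)
      also have "\<dots> \<le> (\<bar>L\<bar> + 1) * d" using w by (intro mult_mono) auto
      also have "\<dots> \<le> e / 3" by (rule d(3))
      finally show ?thesis .
    qed
    have "dist (Y (r m) x) (Y (r n) x) < e" if "m \<ge> N" "n \<ge> N" for m n
    proof -
      let ?a = "Y (r m) x - Y (r m) w" and ?b = "Y (r m) w - Y (r n) w" and ?c = "Y (r n) x - Y (r n) w"
      have "cmod (Y (r m) x - Y (r n) x) = cmod (?a + ?b - ?c)" by simp
      also have "\<dots> \<le> cmod ?a + cmod ?b + cmod ?c"
        by (rule order_trans[OF norm_triangle_ineq4 add_right_mono[OF norm_triangle_ineq]])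
      finally have "cmod (Y (r m) x - Y (r n) x) \<le> cmod ?a + cmod ?b + cmod ?c" .
      then show ?thesis using near[of "r m"] near[of "r n"] N[OF that] by (simp add: dist_norm)
    qed
    then show "\<exists>N. \<forall>m\<ge>N. \<forall>n\<ge>N. dist (Y (r m) x) (Y (r n) x) < e" by blast
  qed
  define g where "g x = lim (\<lambda>n. Y (r n) x)" for x
  have g: "(\<lambda>n. Y (r n) x) \<longlonglongrightarrow> g x" if "x \<ge> 0" for x
    using conv[OF that] by (simp add: g_def convergent_LIMSEQ_iff)
  have [measurable]: "(\<lambda>x. x) \<in> borel_measurable ?M"
    by (intro measurable_restrict_space1 measurable_completion) simp
  have mY[measurable]: "Y n \<in> borel_measurable ?M" for n using Y by (simp add: L2_def)
  have mg[measurable]: "g \<in> borel_measurable ?M"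
    by (rule borel_measurable_LIMSEQ_metric[of "\<lambda>n. Y (r n)"]) (use g mY in auto)
  have Y_tail: "(\<integral>\<^sup>+x. ennreal ((cmod (Y n x))\<^sup>2) * indicator {X..} x \<partial>?M) = ennreal (integral {X..} (\<lambda>x. (cmod (Y n x))\<^sup>2))"
    if "X \<ge> 0" for n X
  proof -
    have i: "(\<lambda>x. (cmod (Y n x))\<^sup>2) integrable_on {X..}"
      by (rule integrable_on_tail[OF L2_integrable_on(1)[OF Y] that]) simp
    have "(\<integral>\<^sup>+x. ennreal ((cmod (Y n x))\<^sup>2) * indicator {X..} x \<partial>?M) =
        (\<integral>\<^sup>+x. ennreal ((cmod (Y n x))\<^sup>2) * indicator {X..} x * indicator {0..} x \<partial>lebesgue)"
      by (subst nn_integral_restrict_space) auto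
    also have "\<dots> = (\<integral>\<^sup>+x. ennreal ((cmod (Y n x))\<^sup>2) * indicator {X..} x \<partial>lebesgue)"
      using that by (intro nn_integral_cong) (auto simp: indicator_def)
    also have "\<dots> = (\<integral>\<^sup>+x. ennreal ((cmod (Y n x))\<^sup>2) * indicator {X..} x \<partial>lborel)"
      by (rule nn_integral_completion)
    also have "\<dots> = ennreal (integral {X..} (\<lambda>x. (cmod (Y n x))\<^sup>2))"
      by (rule nn_integral_has_integral_lebesgue'[OF _ integrable_integral[OF i]]) simp
    finally show ?thesis .
  qed
  have fatou: "(\<integral>\<^sup>+x. ennreal ((cmod (g x))\<^sup>2) * indicator {X..} x \<partial>?M) \<le> ennreal c"
    if "X \<ge> 0" "\<And>n. integral {X..} (\<lambda>x. (cmod (Y n x))\<^sup>2) \<le> c" for X c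
  proof -
    have "(\<integral>\<^sup>+x. ennreal ((cmod (g x))\<^sup>2) * indicator {X..} x \<partial>?M) =
        (\<integral>\<^sup>+x. liminf (\<lambda>n. ennreal ((cmod (Y (r n) x))\<^sup>2) * indicator {X..} x) \<partial>?M)"
    proof (rule nn_integral_cong)
      fix x assume "x \<in> space ?M"
      then have "x \<ge> 0" by simp
      have "(\<lambda>n. ennreal ((cmod (Y (r n) x))\<^sup>2)) \<longlonglongrightarrow> ennreal ((cmod (g x))\<^sup>2)"
        by (intro tendsto_ennrealI tendsto_power tendsto_norm g \<open>x \<ge> 0\<close>)
      then have "(\<lambda>n. ennreal ((cmod (Y (r n) x))\<^sup>2) * indicator {X..} x) \<longlonglongrightarrow> ennreal ((cmod (g x))\<^sup>2) * indicator {X..} x"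
        by (auto simp: indicator_def)
      then show "ennreal ((cmod (g x))\<^sup>2) * indicator {X..} x = liminf (\<lambda>n. ennreal ((cmod (Y (r n) x))\<^sup>2) * indicator {X..} x)"
        by (rule lim_imp_Liminf[symmetric, rotated]) simp
    qed
    also have "\<dots> \<le> liminf (\<lambda>n. \<integral>\<^sup>+x. ennreal ((cmod (Y (r n) x))\<^sup>2) * indicator {X..} x \<partial>?M)"
      by (rule nn_integral_liminf) measurable
    also have "\<dots> \<le> liminf (\<lambda>n. ennreal c)"
      using that by (intro Liminf_mono always_eventually) (simp add: Y_tail ennreal_leI)
    finally show ?thesis by (simp add: Liminf_const)
  qed
  have gL2: "g \<in> L2"
  proof -
    have "(\<integral>\<^sup>+x. ennreal ((cmod (g x))\<^sup>2) \<partial>?M) = (\<integral>\<^sup>+x. ennreal ((cmod (g x))\<^sup>2) * indicator {0..} x \<partial>?M)"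
      by (rule nn_integral_cong) simp
    also have "\<dots> \<le> ennreal B" by (rule fatou) (use norm_le in auto)
    finally have "(\<integral>\<^sup>+x. ennreal ((cmod (g x))\<^sup>2) \<partial>?M) < \<infinity>" by (rule le_less_trans) simp
    then have "integrable ?M (\<lambda>x. (cmod (g x))\<^sup>2)" by (intro integrableI_nonneg) auto
    then show ?thesis using mg by (simp add: L2_def)
  qed
  \<comment> \<open>Working with nonnegative integrals in \<open>ennreal\<close> makes it
    unnecessary to check integrability of the differences.\<close>
  define d where "d n = (\<integral>\<^sup>+x. ennreal ((cmod (Y (r n) x - g x))\<^sup>2) \<partial>?M)" for n
  have ev: "\<forall>\<^sub>F n in sequentially. d n \<le> ennreal e" if "e > 0" for e
  proof -
    \<comment> \<open>One fifth is spent on \<open>{0..X}\<close>; the tail costs four fifths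
      through \<open>|u - v|^2 \<le> 2 |u|^2 + 2 |v|^2\<close>.\<close>
    have "e / 5 > 0" using that by simp
    then obtain X where X: "X \<ge> 0" "\<And>n. integral {X..} (\<lambda>x. (cmod (Y n x))\<^sup>2) \<le> e / 5" using tail by blast
    define c where "c n = (\<integral>\<^sup>+x. ennreal ((cmod (Y (r n) x - g x))\<^sup>2) * indicator {0..X} x \<partial>?M)" for n
    have "c \<longlonglongrightarrow> (\<integral>\<^sup>+x. 0 \<partial>?M)"
      unfolding c_def
    proof (rule nn_integral_dominated_convergence[where w = "\<lambda>x. ennreal ((2 * K X)\<^sup>2) * indicator {0..X} x"])
      fix n
      have gK: "cmod (g x) \<le> K X" if "x \<in> {0..X}" for x
        by (rule Lim_norm_ubound[OF _ g]) (use K[OF X(1)] that in auto)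
      have "(cmod (Y (r n) x - g x))\<^sup>2 \<le> (2 * K X)\<^sup>2" if "x \<in> {0..X}" for x
        using norm_triangle_ineq4[of "Y (r n) x" "g x"] K[OF X(1) that, of "r n"] gK[OF that] by (intro power_mono) auto
      then show "AE x in ?M. ennreal ((cmod (Y (r n) x - g x))\<^sup>2) * indicator {0..X} x \<le> ennreal ((2 * K X)\<^sup>2) * indicator {0..X} x"
        by (intro AE_I2) (auto simp: indicator_def intro!: ennreal_leI)
    next
      have "(\<integral>\<^sup>+x. ennreal ((2 * K X)\<^sup>2) * indicator {0..X} x \<partial>?M) = ennreal ((2 * K X)\<^sup>2) * emeasure ?M {0..X}"
        by (rule nn_integral_cmult_indicator) (simp add: sets_restrict_space_iff)
      also have "emeasure ?M {0..X} = ennreal X" using X(1) by (subst emeasure_restrict_space) auto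
      finally show "(\<integral>\<^sup>+x. ennreal ((2 * K X)\<^sup>2) * indicator {0..X} x \<partial>?M) < \<infinity>"
        by (simp add: ennreal_mult_less_top)
    next
      show "AE x in ?M. (\<lambda>n. ennreal ((cmod (Y (r n) x - g x))\<^sup>2) * indicator {0..X} x) \<longlonglongrightarrow> 0"
      proof (rule AE_I2)
        fix x assume "x \<in> space ?M"
        then have "x \<ge> 0" by simp
        have "(\<lambda>n. ennreal ((cmod (Y (r n) x - g x))\<^sup>2)) \<longlonglongrightarrow> ennreal ((cmod (g x - g x))\<^sup>2)"
          by (intro tendsto_ennrealI tendsto_power tendsto_norm tendsto_diff g tendsto_const \<open>x \<ge> 0\<close>)
        then show "(\<lambda>n. ennreal ((cmod (Y (r n) x - g x))\<^sup>2) * indicator {0..X} x) \<longlonglongrightarrow> 0"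
          by (auto simp: indicator_def)
      qed
    qed auto
    then have "c \<longlonglongrightarrow> 0" by simp
    then have "\<forall>\<^sub>F n in sequentially. c n < ennreal (e / 5)"
      by (rule order_tendstoD) (use that in simp)
    then show ?thesis
    proof eventually_elim
      case (elim n)
      let ?y = "\<lambda>x. ennreal ((cmod (Y (r n) x))\<^sup>2) * indicator {X..} x"
      let ?g = "\<lambda>x. ennreal ((cmod (g x))\<^sup>2) * indicator {X..} x"
      have sq: "(cmod (u - v))\<^sup>2 \<le> 2 * (cmod u)\<^sup>2 + 2 * (cmod v)\<^sup>2" for u v
      proof -
        have "(cmod (u - v))\<^sup>2 \<le> (cmod u + cmod v)\<^sup>2" by (intro power_mono norm_triangle_ineq4) simp
        also have "\<dots> \<le> 2 * (cmod u)\<^sup>2 + 2 * (cmod v)\<^sup>2"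
          using sum_squares_bound[of "cmod u" "cmod v"] by (simp add: power2_sum)
        finally show ?thesis .
      qed
      have "d n \<le> (\<integral>\<^sup>+x. ennreal ((cmod (Y (r n) x - g x))\<^sup>2) * indicator {0..X} x + (2 * ?y x + 2 * ?g x) \<partial>?M)"
        unfolding d_def
      proof (rule nn_integral_mono)
        fix x assume "x \<in> space ?M"
        then have "x \<ge> 0" by simp
        have "ennreal ((cmod (Y (r n) x - g x))\<^sup>2) \<le> ennreal (2 * (cmod (Y (r n) x))\<^sup>2 + 2 * (cmod (g x))\<^sup>2)"
          by (intro ennreal_leI sq)
        then have "ennreal ((cmod (Y (r n) x - g x))\<^sup>2) \<le> 2 * ennreal ((cmod (Y (r n) x))\<^sup>2) + 2 * ennreal ((cmod (g x))\<^sup>2)"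
          by (simp add: ennreal_plus ennreal_mult)
        then show "ennreal ((cmod (Y (r n) x - g x))\<^sup>2) \<le> ennreal ((cmod (Y (r n) x - g x))\<^sup>2) * indicator {0..X} x + (2 * ?y x + 2 * ?g x)"
          using \<open>x \<ge> 0\<close> by (cases "x \<le> X") (auto simp: indicator_def)
      qed
      also have "\<dots> = c n + (2 * integral\<^sup>N ?M ?y + 2 * integral\<^sup>N ?M ?g)"
        unfolding c_def by (simp add: nn_integral_add nn_integral_cmult)
      also have "\<dots> \<le> ennreal (e / 5) + (2 * ennreal (e / 5) + 2 * ennreal (e / 5))"
        using elim fatou[OF X] X(2)[of "r n"] by (intro add_mono mult_left_mono) (auto simp: Y_tail[OF X(1)] intro: ennreal_leI)
      also have "\<dots> = ennreal (e / 5 + (2 * (e / 5) + 2 * (e / 5)))"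
      proof -
        have "2 * ennreal (e / 5) = ennreal (2 * (e / 5))"
          using ennreal_mult[of 2 "e / 5"] that by simp
        then show ?thesis using that by (simp only: ennreal_plus[symmetric])
      qed
      also have "\<dots> = ennreal e" by simp
      finally show ?case .
    qed
  qed
  have "d \<longlonglongrightarrow> 0"
  proof (intro order_tendstoI)
    fix a :: ennreal assume "0 < a"
    then obtain b where b: "0 < b" "b < a" using dense by blast
    then have "b < top" by (meson less_le_trans top_greatest)
    then have "b = ennreal (enn2real b)" "enn2real b > 0" using b(1) by (auto simp: enn2real_positive_iff)
    then have "\<forall>\<^sub>F n in sequentially. d n \<le> b" using ev by metis
    then show "\<forall>\<^sub>F n in sequentially. d n < a" by eventually_elim (use b in auto)
  qed simp
  then have "(\<lambda>n. sqrt (enn2real (d n))) \<longlonglongrightarrow> sqrt (enn2real 0)"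
    by (intro tendsto_real_sqrt tendsto_enn2real) auto
  moreover have "L2norm (\<lambda>x. Y (r n) x - g x) = sqrt (enn2real (d n))" for n
    unfolding d_def by (rule L2_square_nn_integral) measurable
  ultimately have "(\<lambda>n. L2norm (\<lambda>x. Y (r n) x - g x)) \<longlonglongrightarrow> 0" by simp
  with r gL2 that show ?thesis by blast
qed

theorem theorem2:
  fixes q :: "real \<Rightarrow> complex" and x0 :: real and \<alpha>0 \<alpha>1 lam :: complex
    and R :: "(real \<Rightarrow> complex) \<Rightarrow> (real \<Rightarrow> complex)"
  assumes "x0 \<ge> 0"
    and "L1_loc q"
    and "condA q x0"
    and "cmod \<alpha>0 + cmod \<alpha>1 \<noteq> 0"
    and "\<forall>M. \<exists>X\<ge>x0. AE x in lebesgue_on {X..}. rho q x0 x \<ge> M"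
    and "lam \<notin> spectrum_LU q \<alpha>0 \<alpha>1"
    and "is_resolvent_LU q \<alpha>0 \<alpha>1 lam R"
  shows "compact_op_L2 R"
  unfolding compact_op_L2_def
proof (intro allI impI, elim conjE exE)
  fix f :: "nat \<Rightarrow> real \<Rightarrow> complex" and Bf
  assume f: "\<forall>n. f n \<in> L2" and Bf: "\<forall>n. L2norm (f n) \<le> Bf"
  let ?M = "lebesgue_on {0 :: real..}"
  define Y where "Y n = R (f n)" for n
  have YD: "Y n \<in> DU q \<alpha>0 \<alpha>1" and Yf: "AE x in ?M. lexpr q (Y n) x - lam * Y n x = f n x" for n
    using assms(7) f by (auto simp: is_resolvent_LU_def ae_eq_def Y_def)
  have YL2: "Y n \<in> L2" "lexpr q (Y n) \<in> L2" and AC: "AC_loc_from 0 (Y n)" "AC_loc_from 0 (dR 0 (Y n))" and Dm: "Y n \<in> Dmax q" for n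
    using YD[of n] by (auto simp: DU_def Dmax_def)
  have [measurable]: "Y n \<in> borel_measurable ?M" "lexpr q (Y n) \<in> borel_measurable ?M" "f n \<in> borel_measurable ?M" for n
    using YL2 f by (auto simp: L2_def)
  have ints: "integrable ?M (\<lambda>x. (cmod (Y n x))\<^sup>2)" "integrable ?M (\<lambda>x. (cmod (lexpr q (Y n) x))\<^sup>2)"
    "integrable ?M (\<lambda>x. (cmod (f n x))\<^sup>2)" for n
    using YL2 f by (auto simp: L2_def)
  obtain K where K: "\<And>y. y \<in> DU q \<alpha>0 \<alpha>1 \<Longrightarrow> L2norm y \<le> K * L2norm (\<lambda>x. lexpr q y x - lam * y x)"
    using assms(6) by (auto simp: spectrum_LU_def resolvent_set_LU_def)
  have L2norm_nonneg: "0 \<le> L2norm u" for u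
    by (simp add: L2norm_def integral_nonneg_AE)
  \<comment> \<open>The constant of the resolvent estimate carries no sign, hence the absolute
    value.\<close>
  define B1 where "B1 = \<bar>K\<bar> * Bf"
  have Y_norm: "L2norm (Y n) \<le> B1" for n
  proof -
    have "L2norm (\<lambda>x. lexpr q (Y n) x - lam * Y n x) = L2norm (f n)"
      unfolding L2norm_def by (intro arg_cong[where f = sqrt] integral_cong_AE) (use Yf[of n] in auto)
    then have "L2norm (Y n) \<le> K * L2norm (f n)" using K[OF YD[of n]] by simp
    also have "\<dots> \<le> B1" unfolding B1_def using Bf L2norm_nonneg by (intro mult_mono) auto
    finally show ?thesis .
  qed
  have sq: "(L2norm u)\<^sup>2 = integral\<^sup>L ?M (\<lambda>x. (cmod (u x))\<^sup>2)" for u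
    by (simp add: L2norm_def integral_nonneg_AE)
  \<comment> \<open>The sum of the bounds for \<open>Y n\<close> and for
    \<open>lexpr q (Y n) = f n + lam * Y n\<close>, so that a single constant dominates both squared
    norms.\<close>
  define B where "B = B1\<^sup>2 + 2 * Bf\<^sup>2 + 2 * (cmod lam)\<^sup>2 * B1\<^sup>2"
  have "0 \<le> B" by (simp add: B_def)
  have Y2: "(L2norm (Y n))\<^sup>2 \<le> B1\<^sup>2" and f2: "(L2norm (f n))\<^sup>2 \<le> Bf\<^sup>2" for n
    using Y_norm[of n] Bf L2norm_nonneg by (auto intro!: power_mono)
  have g2: "(L2norm (lexpr q (Y n)))\<^sup>2 \<le> 2 * Bf\<^sup>2 + 2 * (cmod lam)\<^sup>2 * B1\<^sup>2" for n
  proof -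
    have "(L2norm (lexpr q (Y n)))\<^sup>2 \<le> integral\<^sup>L ?M (\<lambda>x. 2 * (cmod (f n x))\<^sup>2 + 2 * (cmod lam)\<^sup>2 * (cmod (Y n x))\<^sup>2)"
      unfolding sq
    proof (rule integral_mono_AE)
      show "AE x in ?M. (cmod (lexpr q (Y n) x))\<^sup>2 \<le> 2 * (cmod (f n x))\<^sup>2 + 2 * (cmod lam)\<^sup>2 * (cmod (Y n x))\<^sup>2"
        using Yf[of n]
      proof eventually_elim
        case (elim x)
        then have "lexpr q (Y n) x = f n x + lam * Y n x" by (simp add: algebra_simps)
        then have "cmod (lexpr q (Y n) x) \<le> cmod (f n x) + cmod lam * cmod (Y n x)"
          by (metis norm_mult norm_triangle_ineq)
        then have "(cmod (lexpr q (Y n) x))\<^sup>2 \<le> (cmod (f n x) + cmod lam * cmod (Y n x))\<^sup>2" by (rule power_mono) simp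
        also have "\<dots> \<le> 2 * (cmod (f n x))\<^sup>2 + 2 * (cmod lam * cmod (Y n x))\<^sup>2"
          using sum_squares_bound[of "cmod (f n x)" "cmod lam * cmod (Y n x)"] by (simp add: power2_sum)
        finally show ?case by (simp add: power_mult_distrib)
      qed
    qed (use ints in auto)
    also have "\<dots> = 2 * (L2norm (f n))\<^sup>2 + 2 * (cmod lam)\<^sup>2 * (L2norm (Y n))\<^sup>2"
      unfolding sq using ints[of n] by simp
    also have "\<dots> \<le> 2 * Bf\<^sup>2 + 2 * (cmod lam)\<^sup>2 * B1\<^sup>2"
      using Y2[of n] f2[of n] by (intro add_mono mult_left_mono) auto
    finally show ?thesis .
  qed
  have ball: "Y n \<in> Dmax_ball q B" for n
  proof -
    have "0 \<le> (cmod lam)\<^sup>2 * B1\<^sup>2" "0 \<le> B1\<^sup>2" "0 \<le> Bf\<^sup>2" by auto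
    then have "B1\<^sup>2 \<le> B" "2 * Bf\<^sup>2 + 2 * (cmod lam)\<^sup>2 * B1\<^sup>2 \<le> B" unfolding B_def by linarith+
    then show ?thesis using Dm[of n] Y2[of n] g2[of n] by (auto simp: Dmax_ball_def)
  qed
  obtain r g where "strict_mono r" "g \<in> L2" "(\<lambda>n. L2norm (\<lambda>x. Y (r n) x - g x)) \<longlonglongrightarrow> 0"
  proof (rule L2_compact_criterion[of Y B])
    show "\<exists>K. \<forall>n. \<forall>x\<in>{0..b}. cmod (Y n x) \<le> K" if "b \<ge> 0" for b
      using Dmax_ball_local_bound[OF assms(2) that \<open>0 \<le> B\<close>] ball by metis
    show "\<exists>K. \<forall>n. \<forall>x\<in>{0..b}. \<forall>w\<in>{0..b}. cmod (Y n x - Y n w) \<le> K * \<bar>x - w\<bar>" if b: "b \<ge> 0" for b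
    proof -
      \<comment> \<open>Enlarging to \<open>b + 1\<close> keeps the interval nondegenerate when
        \<open>b = 0\<close>, as one-sided differentiation at the endpoints requires.\<close>
      have "b + 1 \<ge> 0" using b by simp
      from Dmax_ball_local_bound[OF assms(2) this \<open>0 \<le> B\<close>]
      obtain L where L: "\<And>n x. x \<in> {0..b + 1} \<Longrightarrow> cmod (dR 0 (Y n) x) \<le> L"
        using ball by metis
      have "cmod (Y n x - Y n w) \<le> L * norm (x - w)" if "x \<in> {0..b + 1}" "w \<in> {0..b + 1}" for n x w
        by (rule differentiable_bound[where S = "{0..b + 1}" and f' = "\<lambda>x h. h *\<^sub>R dR 0 (Y n) x"])
           (use AC_primitive_has_derivative[OF AC, of _ "b + 1" n] L that b
            in \<open>auto simp: has_vector_derivative_def onorm_scaleR_left onorm_id\<close>)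
      then show ?thesis by (intro exI[of _ L]) auto
    qed
    show "integral {0..} (\<lambda>x. (cmod (Y n x))\<^sup>2) \<le> B" for n
      using ball[of n] by (simp add: L2_integrable_on(2)[OF YL2(1)] Dmax_ball_def)
    show "\<exists>X\<ge>0. \<forall>n. integral {X..} (\<lambda>x. (cmod (Y n x))\<^sup>2) \<le> e" if "e > 0" for e
      using Dmax_ball_tail[OF assms(1,2,3,5) \<open>0 \<le> B\<close> that] ball by metis
  qed (use YL2 in auto)
  then show "\<exists>r g. strict_mono r \<and> g \<in> L2 \<and> (\<lambda>n. L2norm (\<lambda>x. R (f (r n)) x - g x)) \<longlonglongrightarrow> 0"
    by (auto simp: Y_def)
qed

end
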